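(* Let $G_1\supseteq G_2\supseteq\dots\supseteq G_n$ be a chain of Lie groups. Then $$(g_1,\dots,g_n)\cdot(h_1,\dots,h_n)=(g_1\,\mathrm{c}_{g_2\cdots g_n}h_1,\;g_2\,\mathrm{c}_{g_3\cdots g_n}h_2,\;\dots,\;g_nh_n),$$ with $\mathrm{c}_gh=ghg^{-1}$, defines a group multiplication on the set $G_1\times\dots\times G_n$ (the $n$-fold semidirect product, denoted $G_1\rtimes\dots\rtimes G_n$), and each sub-product $G_1\rtimes\dots\rtimes G_k$ is a normal subgroup of the whole product. Moreover, given the right-trivialised tangent vector $v(t)=(v_1(t),\dots,v_n(t))$ of a curve $g(t)=(g_1(t),\dots,g_n(t))$ in $G_1\rtimes\dots\rtimes G_n$, the curve can be reconstructed via the ODE $$\partial_tg_k(t)=\Big(v_k(t)+(\mathrm{Id}-\mathrm{Ad}_{g_k(t)})\sum_{i=k+1}^nv_i(t)\Big)g_k(t)\quad\text{for }k<n,\qquad \partial_tg_n(t)=v_n(t)g_n(t).$$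
   Context: "Chain of Lie groups" means that each $G_{k+1}$ is a Lie subgroup of $G_k$; accordingly the Lie algebras satisfy $\mathfrak{g}_{k+1}\subseteq\mathfrak{g}_k$, and $v_i\in\mathfrak{g}_i$ is regarded as an element of $\mathfrak{g}_k$ for $i>k$. For $v\in\mathfrak{g}_k$ and $g\in G_k$, $vg\in T_gG_k$ denotes the derivative at the identity, in the direction $v$, of $h\mapsto hg$. The right-trivialised tangent vector of a curve $g(t)$ in a Lie group $G$ is the element $v(t)$ of the Lie algebra with $\partial_tg(t)=v(t)g(t)$ (derivative at the identity of $h\mapsto h\cdot g(t)$ applied to $v(t)$), here with respect to the multiplication of the semidirect product; its Lie algebra is identified as a vector space with $\mathfrak{g}_1\times\dots\times\mathfrak{g}_n$. $\mathrm{Ad}$ is the adjoint representation of $G_k$ on $\mathfrak{g}_k$. The sub-product $G_1\rtimes\dots\rtimes G_k$ is identified with the set of tuples $(g_1,\dots,g_k,e,\dots,e)$. *)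

theory Defs
  imports "HOL-Analysis.Analysis" "HOL-Algebra.Coset"
begin

section \<open>Smooth manifolds\<close>

text \<open>
  \<open>C_k_on k E S f\<close>: \<open>f\<close> is \<open>k\<close> times continuously differentiable on \<open>S\<close>, where \<open>S\<close> is an open subset
  of the linear subspace \<open>E\<close> of a Euclidean space. The derivative \<open>frechet_derivative f (at x within S)\<close>
  is uniquely determined on \<open>E\<close> only, hence directions are restricted to \<open>v \<in> E\<close>.
\<close>

primrec C_k_on :: "nat \<Rightarrow> 'e::euclidean_space set \<Rightarrow> 'e set \<Rightarrow> ('e \<Rightarrow> 'f::euclidean_space) \<Rightarrow> bool" where
  "C_k_on 0 E S f \<longleftrightarrow> continuous_on S f"
| "C_k_on (Suc k) E S f \<longleftrightarrow>
     (\<forall>x\<in>S. f differentiable (at x within S)) \<and>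
     (\<forall>v\<in>E. C_k_on k E S (\<lambda>x. frechet_derivative f (at x within S) v))"

definition smooth_on :: "'e::euclidean_space set \<Rightarrow> 'e set \<Rightarrow> ('e \<Rightarrow> 'f::euclidean_space) \<Rightarrow> bool" where
  "smooth_on E S f \<longleftrightarrow> (\<forall>k. C_k_on k E S f)"

text \<open>
  A manifold is a topology with, at each point \<open>p\<close>, a preferred chart \<open>chart M p\<close> defined on \<open>chart_dom M p\<close>;
  these charts form the atlas. Charts take values in a linear subspace \<open>model M\<close> of a Euclidean
  space, so that manifolds of different dimensions can share one type. The tangent space \<open>T\<^sub>p M\<close> is
  \<open>model M\<close>, a tangent vector at \<open>p\<close> being given by its coordinates in the preferred chart at \<open>p\<close>.
\<close>

record ('a, 'e) manifold =
  top_of :: "'a topology"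
  model :: "'e set"
  chart_dom :: "'a \<Rightarrow> 'a set"
  chart :: "'a \<Rightarrow> 'a \<Rightarrow> 'e"

abbreviation "points M \<equiv> topspace (top_of M)"

definition chart_inv :: "('a, 'e) manifold \<Rightarrow> 'a \<Rightarrow> 'e \<Rightarrow> 'a" where
  "chart_inv M p = inv_into (chart_dom M p) (chart M p)"

definition smooth_manifold :: "('a, 'e::euclidean_space) manifold \<Rightarrow> bool" where
  "smooth_manifold M \<longleftrightarrow>
     Hausdorff_space (top_of M) \<and> second_countable (top_of M) \<and> subspace (model M) \<and>
     (\<forall>p\<in>points M.
        p \<in> chart_dom M p \<and> openin (top_of M) (chart_dom M p) \<and>
        openin (top_of_set (model M)) (chart M p ` chart_dom M p) \<and>
        homeomorphic_map (subtopology (top_of M) (chart_dom M p))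
          (top_of_set (chart M p ` chart_dom M p)) (chart M p)) \<and>
     (\<forall>p\<in>points M. \<forall>q\<in>points M.
        smooth_on (model M) (chart M p ` (chart_dom M p \<inter> chart_dom M q))
          (chart M q \<circ> chart_inv M p))"

definition smooth_map ::
    "('a, 'e::euclidean_space) manifold \<Rightarrow> ('b, 'f::euclidean_space) manifold \<Rightarrow> ('a \<Rightarrow> 'b) \<Rightarrow> bool" where
  "smooth_map M N F \<longleftrightarrow>
     continuous_map (top_of M) (top_of N) F \<and>
     (\<forall>p\<in>points M. \<forall>q\<in>points N.
        smooth_on (model M) (chart M p ` (chart_dom M p \<inter> F -` chart_dom N q))
          (chart N q \<circ> F \<circ> chart_inv M p))"

text \<open>
  The differential \<open>T\<^sub>p M \<rightarrow> T\<^bsub>F p\<^esub> N\<close> in the preferred charts at \<open>p\<close> and \<open>F p\<close>; only its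
  restriction to \<open>model M\<close> is meaningful.
\<close>

definition differential ::
    "('a, 'e::euclidean_space) manifold \<Rightarrow> ('b, 'f::euclidean_space) manifold \<Rightarrow> ('a \<Rightarrow> 'b) \<Rightarrow> 'a \<Rightarrow> 'e \<Rightarrow> 'f" where
  "differential M N F p =
     frechet_derivative (chart N (F p) \<circ> F \<circ> chart_inv M p) (at (chart M p p) within model M)"

text \<open>\<open>\<partial>\<^sub>t \<gamma>(t) = w\<close> for a curve \<open>\<gamma>\<close> on the interval \<open>I\<close> (one-sided derivatives at endpoints in \<open>I\<close>).\<close>

definition has_velocity ::
    "('a, 'e::euclidean_space) manifold \<Rightarrow> real set \<Rightarrow> (real \<Rightarrow> 'a) \<Rightarrow> real \<Rightarrow> 'e \<Rightarrow> bool" where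
  "has_velocity M I \<gamma> t w \<longleftrightarrow>
     w \<in> model M \<and> limitin (top_of M) \<gamma> (\<gamma> t) (at t within I) \<and>
     ((\<lambda>s. chart M (\<gamma> t) (\<gamma> s)) has_vector_derivative w) (at t within I)"

definition prod_manifold2 ::
    "('a, 'e::euclidean_space) manifold \<Rightarrow> ('b, 'f::euclidean_space) manifold \<Rightarrow> ('a \<times> 'b, 'e \<times> 'f) manifold" where
  "prod_manifold2 M N =
     \<lparr>top_of = prod_topology (top_of M) (top_of N),
      model = model M \<times> model N,
      chart_dom = (\<lambda>(p, q). chart_dom M p \<times> chart_dom N q),
      chart = (\<lambda>(p, q) (x, y). (chart M p x, chart N q y))\<rparr>"

text \<open>With this product chart at each point, \<open>T\<^sub>p (\<Prod>\<^sub>k M\<^sub>k)\<close> is the space of tuples of vectors in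
  \<open>T\<^bsub>p k\<^esub> M\<^sub>k\<close>.\<close>

definition prod_manifold ::
    "('n::finite \<Rightarrow> ('a, 'e::euclidean_space) manifold) \<Rightarrow> ('n \<Rightarrow> 'a, 'e ^ 'n) manifold" where
  "prod_manifold M =
     \<lparr>top_of = product_topology (\<lambda>k. top_of (M k)) UNIV,
      model = {x. \<forall>k. x $ k \<in> model (M k)},
      chart_dom = (\<lambda>p. {x. \<forall>k. x k \<in> chart_dom (M k) (p k)}),
      chart = (\<lambda>p x. \<chi> k. chart (M k) (p k) (x k))\<rparr>"

section \<open>Lie groups\<close>

definition lie_group :: "'a monoid \<Rightarrow> ('a, 'e::euclidean_space) manifold \<Rightarrow> bool" where
  "lie_group G M \<longleftrightarrow>
     group G \<and> smooth_manifold M \<and> points M = carrier G \<and>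
     smooth_map (prod_manifold2 M M) M (\<lambda>(g, h). g \<otimes>\<^bsub>G\<^esub> h) \<and>
     smooth_map M M (\<lambda>g. inv\<^bsub>G\<^esub> g)"

text \<open>Lie subgroups are immersed: the topology of \<open>H\<close> may be finer than the one induced by \<open>G\<close>.\<close>

definition lie_subgroup ::
    "'a monoid \<Rightarrow> ('a, 'e::euclidean_space) manifold \<Rightarrow> 'a monoid \<Rightarrow> ('a, 'e) manifold \<Rightarrow> bool" where
  "lie_subgroup H N G M \<longleftrightarrow>
     lie_group H N \<and> lie_group G M \<and> subgroup (carrier H) G \<and>
     (\<forall>x\<in>carrier H. \<forall>y\<in>carrier H. x \<otimes>\<^bsub>H\<^esub> y = x \<otimes>\<^bsub>G\<^esub> y) \<and>
     smooth_map N M (\<lambda>x. x) \<and>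
     (\<forall>p\<in>carrier H. inj_on (differential N M (\<lambda>x. x) p) (model N))"

text \<open>The Lie algebra of \<open>G\<close> is \<open>T\<^sub>e G\<close>, that is, \<open>model M\<close> in the preferred chart at \<open>e\<close>.\<close>

definition right_translate :: "'a monoid \<Rightarrow> ('a, 'e::euclidean_space) manifold \<Rightarrow> 'e \<Rightarrow> 'a \<Rightarrow> 'e" where
  "right_translate G M v g = differential M M (\<lambda>h. h \<otimes>\<^bsub>G\<^esub> g) \<one>\<^bsub>G\<^esub> v"

definition conjugate :: "('a, 'b) monoid_scheme \<Rightarrow> 'a \<Rightarrow> 'a \<Rightarrow> 'a" where
  "conjugate G g h = g \<otimes>\<^bsub>G\<^esub> h \<otimes>\<^bsub>G\<^esub> inv\<^bsub>G\<^esub> g"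

definition Ad :: "'a monoid \<Rightarrow> ('a, 'e::euclidean_space) manifold \<Rightarrow> 'a \<Rightarrow> 'e \<Rightarrow> 'e" where
  "Ad G M g = differential M M (conjugate G g) \<one>\<^bsub>G\<^esub>"

definition right_trivialised_tangent ::
    "'a monoid \<Rightarrow> ('a, 'e::euclidean_space) manifold \<Rightarrow> real set \<Rightarrow> (real \<Rightarrow> 'a) \<Rightarrow> (real \<Rightarrow> 'e) \<Rightarrow> bool" where
  "right_trivialised_tangent G M I \<gamma> v \<longleftrightarrow>
     (\<forall>t\<in>I. v t \<in> model M \<and> has_velocity M I \<gamma> t (right_translate G M (v t) (\<gamma> t)))"

section \<open>Chains and their semidirect product\<close>

text \<open>
  The index set \<open>{1,\<dots>,n}\<close> of a chain is rendered as a finite linearly ordered type \<open>'n\<close>,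
  with \<open>n\<close> itself corresponding to \<open>Max UNIV\<close>.
\<close>

definition lie_chain ::
    "('n::{finite,linorder} \<Rightarrow> 'a monoid) \<Rightarrow> ('n \<Rightarrow> ('a, 'e::euclidean_space) manifold) \<Rightarrow> bool" where
  "lie_chain G M \<longleftrightarrow>
     (\<forall>k. lie_group (G k) (M k)) \<and>
     (\<forall>k l. k < l \<and> \<not> (\<exists>i. k < i \<and> i < l) \<longrightarrow> lie_subgroup (G l) (M l) (G k) (M k))"

text \<open>The ordered product \<open>g\<^bsub>k+1\<^esub> \<cdots> g\<^sub>n\<close>, formed in \<open>G\<^sub>k\<close>.\<close>

definition tail_prod :: "('n::{finite,linorder} \<Rightarrow> 'a monoid) \<Rightarrow> 'n \<Rightarrow> ('n \<Rightarrow> 'a) \<Rightarrow> 'a" where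
  "tail_prod G k g =
     foldr (\<lambda>i x. g i \<otimes>\<^bsub>G k\<^esub> x) (sorted_list_of_set {k<..}) \<one>\<^bsub>G k\<^esub>"

definition semidirect :: "('n::{finite,linorder} \<Rightarrow> 'a monoid) \<Rightarrow> ('n \<Rightarrow> 'a) monoid" where
  "semidirect G =
     \<lparr>carrier = {g. \<forall>k. g k \<in> carrier (G k)},
      mult = (\<lambda>g h k. g k \<otimes>\<^bsub>G k\<^esub> conjugate (G k) (tail_prod G k g) (h k)),
      one = (\<lambda>k. \<one>\<^bsub>G k\<^esub>)\<rparr>"

definition sub_product :: "('n::{finite,linorder} \<Rightarrow> 'a monoid) \<Rightarrow> 'n \<Rightarrow> ('n \<Rightarrow> 'a) set" where
  "sub_product G k = {g \<in> carrier (semidirect G). \<forall>i>k. g i = \<one>\<^bsub>G i\<^esub>}"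

text \<open>The inclusion of the Lie algebra of \<open>G\<^sub>i\<close> into that of \<open>G\<^sub>k\<close>, for \<open>i \<ge> k\<close>.\<close>

definition lie_incl ::
    "('n \<Rightarrow> 'a monoid) \<Rightarrow> ('n \<Rightarrow> ('a, 'e::euclidean_space) manifold) \<Rightarrow> 'n \<Rightarrow> 'n \<Rightarrow> 'e \<Rightarrow> 'e" where
  "lie_incl G M i k = differential (M i) (M k) (\<lambda>x. x) \<one>\<^bsub>G i\<^esub>"

definition tail_sum ::
    "('n::{finite,linorder} \<Rightarrow> 'a monoid) \<Rightarrow> ('n \<Rightarrow> ('a, 'e::euclidean_space) manifold) \<Rightarrow> 'n \<Rightarrow> ('e, 'n) vec \<Rightarrow> 'e" where
  "tail_sum G M k v = (\<Sum>i\<in>{k<..}. lie_incl G M i k (v $ i))"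

definition solves_reconstruction_ode ::
    "('n::{finite,linorder} \<Rightarrow> 'a monoid) \<Rightarrow> ('n \<Rightarrow> ('a, 'e::euclidean_space) manifold) \<Rightarrow>
     real set \<Rightarrow> (real \<Rightarrow> ('e, 'n) vec) \<Rightarrow> (real \<Rightarrow> 'n \<Rightarrow> 'a) \<Rightarrow> bool" where
  "solves_reconstruction_ode G M I v g \<longleftrightarrow>
     (\<forall>t\<in>I.
        (\<forall>k. k < Max UNIV \<longrightarrow>
           has_velocity (M k) I (\<lambda>s. g s k) t
             (right_translate (G k) (M k)
                (v t $ k + (tail_sum G M k (v t) - Ad (G k) (M k) (g t k) (tail_sum G M k (v t))))
                (g t k))) \<and>
        (let n = Max UNIV in
           has_velocity (M n) I (\<lambda>s. g s n) t (right_translate (G n) (M n) (v t $ n) (g t n))))"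

end

theory Submission
  imports Defs
begin

text \<open>
  The map \<open>\<Psi>\<^sub>k(g) = g\<^sub>k g\<^bsub>k+1\<^esub> \<cdots> g\<^sub>n\<close> (\<open>total_prod k\<close> below) is a homomorphism from the semidirect product to
  \<open>G\<^sub>k\<close>, and \<open>(\<Psi>\<^sub>1, \<dots>, \<Psi>\<^sub>n)\<close> is a bijection onto the direct product. The group axioms follow, and the
  sub-product of index \<open>k\<close> is the common kernel of the \<open>\<Psi>\<^sub>i\<close> with \<open>i > k\<close>, hence normal.

  The differential of \<open>\<Psi>\<^sub>k\<close> at the identity is \<open>v \<mapsto> v\<^sub>k + \<dots> + v\<^sub>n\<close>, so along the curve both \<open>\<Psi>\<^sub>k(g)\<close> and
  \<open>y = g\<^bsub>k+1\<^esub> \<cdots> g\<^sub>n\<close> have explicit right-trivialised velocities \<open>v\<^sub>k + s\<close> and \<open>s = v\<^bsub>k+1\<^esub> + \<dots> + v\<^sub>n\<close>. The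
  product rule for \<open>\<Psi>\<^sub>k(g) = g\<^sub>k y\<close> then yields the equation for \<open>g\<^sub>k\<close>. Conversely, every solution \<open>g'\<close> of
  that equation makes \<open>g'\<^sub>k y\<close> solve \<open>\<partial>a = (v\<^sub>k + s) a\<close>, and two solutions \<open>a\<close>, \<open>b\<close> of the latter differ by
  a constant, as \<open>a\<^sup>-\<^sup>1 b\<close> has velocity \<open>0\<close>.
\<close>

section \<open>Chains of groups and their semidirect product\<close>

text \<open>The set \<open>{k<..}\<close> shrinks strictly as \<open>k\<close> grows, so its
  cardinality is a measure. The recursions below start at the largest index, where the induction
  hypothesis is vacuous.\<close>

lemma finite_linorder_upward_induct [case_names greater]:
  fixes k :: "'n::{finite,linorder}"
  assumes "\<And>k. (\<And>l. k < l \<Longrightarrow> P l) \<Longrightarrow> P k"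
  shows "P k"
proof (induction "card {k<..}" arbitrary: k rule: less_induct)
  case less
  have "P l" if "k < l" for l
  proof (rule less)
    from that have "{l<..} \<subset> {k<..}"
      by auto
    then show "card {l<..} < card {k<..}"
      by (simp add: psubset_card_mono)
  qed
  with assms show ?case
    by blast
qed

text \<open>The successor \<open>m\<close> is the minimum of \<open>{k<..}\<close>. The set equation
  is what unrolls tail products and tail sums by one factor or summand.\<close>

lemma finite_linorder_succ_cases:
  fixes k :: "'n::{finite,linorder}"
  obtains (max) "{k<..} = {}" "k = Max UNIV"
    | (succ) m where "k < m" "\<not> (\<exists>i. k < i \<and> i < m)" "{k<..} = insert m {m<..}"
proof (cases "{k<..} = {}")
  case True
  then have "k = Max UNIV"
    by (metis Max_ge Max_in UNIV_I empty_iff finite finite_UNIV greaterThan_iff order_le_imp_less_or_eq)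
  with True max show ?thesis
    by blast
next
  case False
  define m where "m = Min {k<..}"
  have "k < m"
    using Min_in[OF _ False] by (simp add: m_def)
  moreover have least: "m \<le> i" if "k < i" for i
    using that by (simp add: m_def)
  then have "\<not> (\<exists>i. k < i \<and> i < m)"
    by (meson leD)
  moreover have "{k<..} = insert m {m<..}"
    using \<open>k < m\<close> least by (auto simp: order_le_less)
  ultimately show ?thesis
    using succ by blast
qed

text \<open>\<open>lie_chain\<close> relates consecutive indices only; a transitive relation extends
  from these to all pairs by walking down from \<open>l\<close>.\<close>

lemma less_induct_consecutive:
  fixes k l :: "'n::{finite,linorder}"
  assumes "k < l"
    and step: "\<And>k l. k < l \<Longrightarrow> \<not> (\<exists>i. k < i \<and> i < l) \<Longrightarrow> R k l"
    and trans: "\<And>k m l. k < m \<Longrightarrow> m < l \<Longrightarrow> R k m \<Longrightarrow> R m l \<Longrightarrow> R k l"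
  shows "R k l"
  using \<open>k < l\<close>
proof (induction k rule: finite_linorder_upward_induct)
  case (greater k)
  show ?case
  proof (cases k rule: finite_linorder_succ_cases)
    case max
    with greater show ?thesis
      by auto
  next
    case (succ m)
    with greater have "l = m \<or> m < l"
      by (metis not_less_iff_gr_or_eq)
    with succ greater step trans show ?thesis
      by blast
  qed
qed

section \<open>Tail products in a chain of abstract groups\<close>

text \<open>This isolates the algebra of the chain. Every \<open>G k\<close> carries its own
  operations, so passing between two members must be licensed by \<open>mult_eq\<close>.\<close>

locale group_chain =
  fixes G :: "'n::{finite,linorder} \<Rightarrow> 'a monoid"
  assumes group [intro, simp]: "group (G k)"
    and carrier_subset: "k < l \<Longrightarrow> carrier (G l) \<subseteq> carrier (G k)"
    and mult_eq: "k < l \<Longrightarrow> x \<in> carrier (G l) \<Longrightarrow> y \<in> carrier (G l) \<Longrightarrow>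
      x \<otimes>\<^bsub>G l\<^esub> y = x \<otimes>\<^bsub>G k\<^esub> y"
begin

lemma monoid [intro, simp]: "monoid (G k)"
  by (simp add: group.is_monoid)

lemma carrier_mono: "k < l \<Longrightarrow> x \<in> carrier (G l) \<Longrightarrow> x \<in> carrier (G k)"
  using carrier_subset by blast

text \<open>The unit of the smaller group is idempotent in the larger one, and the only idempotent
  of a group is its unit.\<close>

lemma one_eq:
  assumes "k < l"
  shows "\<one>\<^bsub>G l\<^esub> = \<one>\<^bsub>G k\<^esub>"
proof -
  have one: "\<one>\<^bsub>G l\<^esub> \<in> carrier (G k)"
    using carrier_mono[OF assms] by (simp add: monoid.one_closed)
  then have "\<one>\<^bsub>G l\<^esub> \<otimes>\<^bsub>G k\<^esub> \<one>\<^bsub>G l\<^esub> = \<one>\<^bsub>G l\<^esub>"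
    using assms by (simp add: monoid.l_one monoid.one_closed flip: mult_eq)
  with one show ?thesis
    by (metis group group.l_cancel_one)
qed

lemma foldr_mult_closed:
  assumes "\<And>i. i \<in> set xs \<Longrightarrow> m \<le> i \<and> g i \<in> carrier (G i)"
  shows "foldr (\<lambda>i x. g i \<otimes>\<^bsub>G m\<^esub> x) xs \<one>\<^bsub>G m\<^esub> \<in> carrier (G m)"
  using assms
proof (induction xs)
  case (Cons i xs)
  then have "g i \<in> carrier (G m)"
    using carrier_mono[of m i] by (force simp: order_le_less)
  with Cons show ?case
    by (simp add: monoid.m_closed)
qed (simp add: monoid.one_closed)

text \<open>Tail products are formed in \<open>G k\<close> although their factors lie in the smaller
  \<open>G m\<close>. Moving the computation to \<open>G m\<close> is what makes them recursive in
  \<open>k\<close>.\<close>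

lemma foldr_mult_eq:
  assumes "k < m" and "\<And>i. i \<in> set xs \<Longrightarrow> m \<le> i \<and> g i \<in> carrier (G i)"
  shows "foldr (\<lambda>i x. g i \<otimes>\<^bsub>G k\<^esub> x) xs \<one>\<^bsub>G k\<^esub> = foldr (\<lambda>i x. g i \<otimes>\<^bsub>G m\<^esub> x) xs \<one>\<^bsub>G m\<^esub>"
  using assms(2)
proof (induction xs)
  case Nil
  then show ?case
    by (simp add: one_eq[OF \<open>k < m\<close>])
next
  case (Cons i xs)
  then have "g i \<in> carrier (G m)"
    using carrier_mono[of m i] by (force simp: order_le_less)
  with Cons show ?case
    by (simp add: mult_eq[OF \<open>k < m\<close>] foldr_mult_closed)
qed

definition total_prod :: "'n \<Rightarrow> ('n \<Rightarrow> 'a) \<Rightarrow> 'a" where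
  "total_prod k g = g k \<otimes>\<^bsub>G k\<^esub> tail_prod G k g"

lemma carrier_semidirect: "g \<in> carrier (semidirect G) \<longleftrightarrow> (\<forall>k. g k \<in> carrier (G k))"
  by (simp add: semidirect_def)

lemma tail_prod_closed:
  "g \<in> carrier (semidirect G) \<Longrightarrow> tail_prod G k g \<in> carrier (G k)"
  unfolding tail_prod_def by (rule foldr_mult_closed) (auto simp: carrier_semidirect)

lemma total_prod_closed:
  "g \<in> carrier (semidirect G) \<Longrightarrow> total_prod k g \<in> carrier (G k)"
  by (simp add: total_prod_def tail_prod_closed monoid.m_closed carrier_semidirect)

lemma tail_prod_max: "{k<..} = {} \<Longrightarrow> tail_prod G k g = \<one>\<^bsub>G k\<^esub>"
  by (simp add: tail_prod_def)

text \<open>The recursion behind all inductions on \<open>k\<close>: the sorted list of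
  \<open>{k<..}\<close> starts with \<open>m\<close>, and the whole product may be formed in
  \<open>G m\<close>.\<close>

lemma tail_prod_succ:
  assumes "k < m" "{k<..} = insert m {m<..}" "g \<in> carrier (semidirect G)"
  shows "tail_prod G k g = total_prod m g"
proof -
  have "sorted_list_of_set {k<..} = m # sorted_list_of_set {m<..}"
  proof -
    have "Min {k<..} = m"
      unfolding assms(2) by (rule Min_eqI) auto
    moreover have "{k<..} - {m} = {m<..}"
      unfolding assms(2) by auto
    ultimately show ?thesis
      using assms(1) by (subst sorted_list_of_set_nonempty) auto
  qed
  then have "tail_prod G k g = foldr (\<lambda>i x. g i \<otimes>\<^bsub>G k\<^esub> x) (m # sorted_list_of_set {m<..}) \<one>\<^bsub>G k\<^esub>"
    by (simp add: tail_prod_def)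
  also have "\<dots> = foldr (\<lambda>i x. g i \<otimes>\<^bsub>G m\<^esub> x) (m # sorted_list_of_set {m<..}) \<one>\<^bsub>G m\<^esub>"
    using assms by (intro foldr_mult_eq) (auto simp: carrier_semidirect)
  finally show ?thesis
    by (simp add: total_prod_def tail_prod_def)
qed

lemma mult_semidirect:
  "(g \<otimes>\<^bsub>semidirect G\<^esub> h) k = g k \<otimes>\<^bsub>G k\<^esub> conjugate (G k) (tail_prod G k g) (h k)"
  by (simp add: semidirect_def)

lemma semidirect_mult_closed:
  assumes "g \<in> carrier (semidirect G)" "h \<in> carrier (semidirect G)"
  shows "g \<otimes>\<^bsub>semidirect G\<^esub> h \<in> carrier (semidirect G)"
  using assms tail_prod_closed[OF assms(1)]
  by (simp add: carrier_semidirect mult_semidirect conjugate_def monoid.m_closed group.inv_closed)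

lemma one_semidirect: "\<one>\<^bsub>semidirect G\<^esub> = (\<lambda>k. \<one>\<^bsub>G k\<^esub>)"
  by (simp add: semidirect_def)

lemma semidirect_one_closed: "\<one>\<^bsub>semidirect G\<^esub> \<in> carrier (semidirect G)"
  by (simp add: carrier_semidirect one_semidirect monoid.one_closed)

text \<open>In \<open>a (y b y^-1) (y z)\<close> the middle \<open>y^-1 y\<close> cancels. This is
  the reason for the conjugation in the semidirect multiplication.\<close>

lemma conjugation_telescope:
  assumes "group H" "a \<in> carrier H" "b \<in> carrier H" "y \<in> carrier H" "z \<in> carrier H"
  shows "(a \<otimes>\<^bsub>H\<^esub> conjugate H y b) \<otimes>\<^bsub>H\<^esub> (y \<otimes>\<^bsub>H\<^esub> z) = (a \<otimes>\<^bsub>H\<^esub> y) \<otimes>\<^bsub>H\<^esub> (b \<otimes>\<^bsub>H\<^esub> z)"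
proof -
  interpret group H by fact
  have "inv\<^bsub>H\<^esub> y \<otimes>\<^bsub>H\<^esub> (y \<otimes>\<^bsub>H\<^esub> z) = z"
    using assms by (simp flip: m_assoc)
  with assms show ?thesis
    by (simp add: conjugate_def m_assoc)
qed

text \<open>Both claims go through one induction, since the tail product at \<open>k\<close> is the
  total product at the successor of \<open>k\<close>; the total product then follows by
  \<open>conjugation_telescope\<close>.\<close>

lemma prod_mult:
  assumes g: "g \<in> carrier (semidirect G)" and h: "h \<in> carrier (semidirect G)"
  shows "tail_prod G k (g \<otimes>\<^bsub>semidirect G\<^esub> h) = tail_prod G k g \<otimes>\<^bsub>G k\<^esub> tail_prod G k h"
    and "total_prod k (g \<otimes>\<^bsub>semidirect G\<^esub> h) = total_prod k g \<otimes>\<^bsub>G k\<^esub> total_prod k h"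
proof -
  have "tail_prod G k (g \<otimes>\<^bsub>semidirect G\<^esub> h) = tail_prod G k g \<otimes>\<^bsub>G k\<^esub> tail_prod G k h \<and>
    total_prod k (g \<otimes>\<^bsub>semidirect G\<^esub> h) = total_prod k g \<otimes>\<^bsub>G k\<^esub> total_prod k h"
  proof (induction k rule: finite_linorder_upward_induct)
    case (greater k)
    have tail: "tail_prod G k (g \<otimes>\<^bsub>semidirect G\<^esub> h) = tail_prod G k g \<otimes>\<^bsub>G k\<^esub> tail_prod G k h"
    proof (cases k rule: finite_linorder_succ_cases)
      case max
      then show ?thesis
        by (simp add: tail_prod_max monoid.l_one monoid.one_closed)
    next
      case (succ m)
      with greater g h show ?thesis
        by (simp add: tail_prod_succ semidirect_mult_closed total_prod_closed
            mult_eq[OF succ(1)])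
    qed
    moreover have "total_prod k (g \<otimes>\<^bsub>semidirect G\<^esub> h) = total_prod k g \<otimes>\<^bsub>G k\<^esub> total_prod k h"
      unfolding total_prod_def tail mult_semidirect
      using g h by (intro conjugation_telescope) (auto simp: tail_prod_closed carrier_semidirect)
    ultimately show ?case
      by blast
  qed
  then show "tail_prod G k (g \<otimes>\<^bsub>semidirect G\<^esub> h) = tail_prod G k g \<otimes>\<^bsub>G k\<^esub> tail_prod G k h"
    and "total_prod k (g \<otimes>\<^bsub>semidirect G\<^esub> h) = total_prod k g \<otimes>\<^bsub>G k\<^esub> total_prod k h"
    by auto
qed

lemma tail_prod_eqI:
  assumes g: "g \<in> carrier (semidirect G)" and h: "h \<in> carrier (semidirect G)"
    and eq: "\<And>i. k < i \<Longrightarrow> total_prod i g = total_prod i h"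
  shows "tail_prod G k g = tail_prod G k h"
proof (cases k rule: finite_linorder_succ_cases)
  case (succ m)
  with assms show ?thesis
    by (simp add: tail_prod_succ)
qed (simp add: tail_prod_max)

text \<open>A component is recovered by cancelling the tail product from the total product. Only
  indices from \<open>k\<close> upwards enter, which \<open>sub_product_iff\<close>
  exploits.\<close>

lemma total_prod_inject:
  assumes g: "g \<in> carrier (semidirect G)" and h: "h \<in> carrier (semidirect G)"
    and eq: "\<And>i. k \<le> i \<Longrightarrow> total_prod i g = total_prod i h"
  shows "g k = h k"
proof -
  have "tail_prod G k g = tail_prod G k h"
    using assms by (intro tail_prod_eqI) auto
  with eq[of k] have "g k \<otimes>\<^bsub>G k\<^esub> tail_prod G k g = h k \<otimes>\<^bsub>G k\<^esub> tail_prod G k g"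
    by (simp add: total_prod_def)
  with g h tail_prod_closed[OF g, of k] show ?thesis
    by (simp add: carrier_semidirect group.right_cancel)
qed

lemma prod_one:
  shows "tail_prod G k \<one>\<^bsub>semidirect G\<^esub> = \<one>\<^bsub>G k\<^esub>" and "total_prod k \<one>\<^bsub>semidirect G\<^esub> = \<one>\<^bsub>G k\<^esub>"
proof -
  have "tail_prod G k \<one>\<^bsub>semidirect G\<^esub> = \<one>\<^bsub>G k\<^esub> \<and> total_prod k \<one>\<^bsub>semidirect G\<^esub> = \<one>\<^bsub>G k\<^esub>"
  proof (induction k rule: finite_linorder_upward_induct)
    case (greater k)
    have "tail_prod G k \<one>\<^bsub>semidirect G\<^esub> = \<one>\<^bsub>G k\<^esub>"
    proof (cases k rule: finite_linorder_succ_cases)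
      case (succ m)
      with greater show ?thesis
        by (simp add: tail_prod_succ semidirect_one_closed one_eq)
    qed (rule tail_prod_max)
    then show ?case
      by (simp add: total_prod_def one_semidirect monoid.l_one monoid.one_closed)
  qed
  then show "tail_prod G k \<one>\<^bsub>semidirect G\<^esub> = \<one>\<^bsub>G k\<^esub>" and "total_prod k \<one>\<^bsub>semidirect G\<^esub> = \<one>\<^bsub>G k\<^esub>"
    by auto
qed

text \<open>Reduces every identity in the semidirect product to identities in the groups
  \<open>G k\<close>, where \<open>prod_mult\<close> and \<open>prod_one\<close> evaluate both
  sides.\<close>

lemma semidirect_eqI:
  assumes "g \<in> carrier (semidirect G)" "h \<in> carrier (semidirect G)"
    and "\<And>k. total_prod k g = total_prod k h"
  shows "g = h"
  by (rule ext, rule total_prod_inject[OF assms])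

section \<open>Group axioms and normal sub-products\<close>

lemma semidirect_group: "group (semidirect G)"
proof (rule groupI)
  fix g assume g: "g \<in> carrier (semidirect G)"
  \<comment> \<open>The formula for the inverse is forced: its total and tail products must be the
    inverses of those of \<open>g\<close>, and a component is the total product times the inverse of
    the tail product.\<close>
  define h where "h k = inv\<^bsub>G k\<^esub> total_prod k g \<otimes>\<^bsub>G k\<^esub> tail_prod G k g" for k
  have h: "h \<in> carrier (semidirect G)"
    using g by (simp add: carrier_semidirect h_def total_prod_closed tail_prod_closed
        monoid.m_closed group.inv_closed)
  have h_prod: "tail_prod G k h = inv\<^bsub>G k\<^esub> tail_prod G k g \<and> total_prod k h = inv\<^bsub>G k\<^esub> total_prod k g" for k
  proof (induction k rule: finite_linorder_upward_induct)
    case (greater k)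
    have tail: "tail_prod G k h = inv\<^bsub>G k\<^esub> tail_prod G k g"
    proof (cases k rule: finite_linorder_succ_cases)
      case max
      then show ?thesis
        by (simp add: tail_prod_max monoid.inv_one)
    next
      \<comment> \<open>The induction hypothesis speaks of the inverse in \<open>G m\<close>. It is
        also a left inverse in \<open>G k\<close>, so the two inverses coincide.\<close>
      case (succ m)
      have "inv\<^bsub>G m\<^esub> total_prod m g = inv\<^bsub>G k\<^esub> total_prod m g"
        using g group.l_inv[OF group, of "total_prod m g" m]
        by (intro group.inv_equality[OF group, symmetric])
          (simp_all add: carrier_mono[OF succ(1)] group.inv_closed total_prod_closed one_eq[OF succ(1)]
            flip: mult_eq[OF succ(1)])
      with succ greater g h show ?thesis
        by (simp add: tail_prod_succ)
    qed
    with g have "total_prod k h = inv\<^bsub>G k\<^esub> total_prod k g"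
      by (simp add: total_prod_def[of k h] h_def monoid.m_assoc group.inv_closed
          total_prod_closed tail_prod_closed group.r_inv monoid.r_one)
    with tail show ?case
      by blast
  qed
  have "h \<otimes>\<^bsub>semidirect G\<^esub> g = \<one>\<^bsub>semidirect G\<^esub>"
    using g h h_prod
    by (intro semidirect_eqI semidirect_mult_closed semidirect_one_closed)
      (simp_all add: prod_mult prod_one group.l_inv total_prod_closed)
  with h show "\<exists>h\<in>carrier (semidirect G). h \<otimes>\<^bsub>semidirect G\<^esub> g = \<one>\<^bsub>semidirect G\<^esub>"
    by blast
next
  fix g h j
  assume "g \<in> carrier (semidirect G)" "h \<in> carrier (semidirect G)" "j \<in> carrier (semidirect G)"
  then show "g \<otimes>\<^bsub>semidirect G\<^esub> h \<otimes>\<^bsub>semidirect G\<^esub> j = g \<otimes>\<^bsub>semidirect G\<^esub> (h \<otimes>\<^bsub>semidirect G\<^esub> j)"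
    by (intro semidirect_eqI semidirect_mult_closed)
      (simp_all add: prod_mult semidirect_mult_closed total_prod_closed monoid.m_assoc)
next
  fix g assume "g \<in> carrier (semidirect G)"
  then show "\<one>\<^bsub>semidirect G\<^esub> \<otimes>\<^bsub>semidirect G\<^esub> g = g"
    by (intro semidirect_eqI semidirect_mult_closed semidirect_one_closed)
      (simp_all add: prod_mult prod_one semidirect_one_closed total_prod_closed monoid.l_one)
qed (simp_all add: semidirect_mult_closed semidirect_one_closed)

text \<open>Turns the condition on components into membership in kernels of homomorphisms, from
  which the subgroup and normality properties are immediate. One direction is an upward induction,
  the other compares \<open>g\<close> with the unit by \<open>total_prod_inject\<close>.\<close>

lemma sub_product_iff:
  "g \<in> sub_product G k \<longleftrightarrow> g \<in> carrier (semidirect G) \<and> (\<forall>i>k. total_prod i g = \<one>\<^bsub>G i\<^esub>)"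
proof (cases "g \<in> carrier (semidirect G)")
  case g: True
  have "total_prod i g = \<one>\<^bsub>G i\<^esub>" if "\<forall>i>k. g i = \<one>\<^bsub>G i\<^esub>" "k < i" for i
    using that(2)
  proof (induction i rule: finite_linorder_upward_induct)
    case (greater i)
    then have "tail_prod G i g = tail_prod G i \<one>\<^bsub>semidirect G\<^esub>"
      by (intro tail_prod_eqI g semidirect_one_closed) (auto simp: prod_one)
    with that greater show ?case
      by (simp add: prod_one total_prod_def monoid.l_one monoid.one_closed)
  qed
  moreover have "g i = \<one>\<^bsub>G i\<^esub>" if "\<forall>i>k. total_prod i g = \<one>\<^bsub>G i\<^esub>" "k < i" for i
    using total_prod_inject[OF g semidirect_one_closed, of i] that
    by (simp add: prod_one) (simp add: one_semidirect)
  ultimately show ?thesis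
    using g by (auto simp: sub_product_def)
qed (simp add: sub_product_def)

lemma total_prod_hom: "group_hom (semidirect G) (G k) (total_prod k)"
  using semidirect_group
  by (intro group_hom.intro group_hom_axioms.intro homI) (auto simp: prod_mult total_prod_closed)

lemma sub_product_normal: "sub_product G k \<lhd> semidirect G"
proof -
  interpret group "semidirect G"
    by (rule semidirect_group)
  interpret hom: group_hom "semidirect G" "G i" "total_prod i" for i
    by (rule total_prod_hom)
  show ?thesis
  proof (rule normal_invI)
    show "subgroup (sub_product G k) (semidirect G)"
    proof (rule subgroupI)
      have "\<one>\<^bsub>semidirect G\<^esub> \<in> sub_product G k"
        by (simp add: sub_product_iff)
      then show "sub_product G k \<noteq> {}"
        by blast
    qed (auto simp: sub_product_iff)
  qed (auto simp: sub_product_iff)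
qed

end

section \<open>Regular charts\<close>

text \<open>Lets a derivative within a chart image, or within the preimage of a chart domain, be
  traded for one within the ambient set.\<close>

lemma at_within_eqI:
  assumes "S \<subseteq> T" "\<forall>\<^sub>F x in at a within T. x \<in> S"
  shows "at a within S = at a within T"
proof (rule filter_eqI)
  fix P
  show "eventually P (at a within S) \<longleftrightarrow> eventually P (at a within T)"
  proof
    assume "eventually P (at a within S)"
    then have "\<forall>\<^sub>F x in at a within T. x \<in> S \<longrightarrow> P x"
      using assms(1) unfolding eventually_at_filter by (auto elim: eventually_mono)
    with assms(2) show "eventually P (at a within T)"
      by eventually_elim simp
  qed (use assms(1) at_le filter_leD in blast)
qed

text \<open>Recasts limits in abstract topologies as filter limits, so that they compose with chart
  maps.\<close>

lemma limitin_iff_filterlim: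
  "limitin X f l F \<longleftrightarrow> l \<in> topspace X \<and> filterlim f (nhdsin X l) F"
proof
  assume *: "limitin X f l F"
  then have l: "l \<in> topspace X"
    by (rule limitin_topspace)
  have "\<forall>\<^sub>F x in F. P (f x)" if P: "eventually P (nhdsin X l)" for P
  proof -
    from P l obtain S where S: "openin X S" "l \<in> S" "\<forall>x\<in>S. P x"
      by (auto simp: eventually_nhdsin)
    have "\<forall>\<^sub>F x in F. f x \<in> S"
      using * S(1,2) by (rule limitinD)
    then show ?thesis
      by (rule eventually_mono) (use S(3) in blast)
  qed
  with l show "l \<in> topspace X \<and> filterlim f (nhdsin X l) F"
    by (simp add: filterlim_iff)
next
  assume *: "l \<in> topspace X \<and> filterlim f (nhdsin X l) F"
  have "\<forall>\<^sub>F x in F. f x \<in> U" if "openin X U" "l \<in> U" for U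
  proof -
    have "eventually (\<lambda>x. x \<in> U) (nhdsin X l)"
      using that unfolding eventually_nhdsin by blast
    with * show ?thesis
      by (auto simp: filterlim_iff)
  qed
  with * show "limitin X f l F"
    by (simp add: limitin_def)
qed

lemma limitin_filterlim_compose:
  "limitin X f l F \<Longrightarrow> filterlim g F H \<Longrightarrow> limitin X (\<lambda>x. f (g x)) l H"
  unfolding limitin_iff_filterlim by (blast intro: filterlim_compose)

text \<open>A derivative within a subspace is determined only along the subspace. Restricting to a
  line gives an ordinary one-variable derivative, which is unique.\<close>

lemma has_derivative_line:
  assumes "(f has_derivative D) (at x within S)" "\<And>t. x + t *\<^sub>R v \<in> S"
  shows "((\<lambda>t. f (x + t *\<^sub>R v)) has_vector_derivative D v) (at 0)"
proof -
  have "((\<lambda>t. x + t *\<^sub>R v) has_derivative (\<lambda>t. t *\<^sub>R v)) (at 0)"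
    by (auto intro!: derivative_eq_intros)
  moreover have "(f has_derivative D) (at (x + 0 *\<^sub>R v) within range (\<lambda>t. x + t *\<^sub>R v))"
    using assms by (auto intro: has_derivative_subset)
  ultimately have "((\<lambda>t. f (x + t *\<^sub>R v)) has_derivative (\<lambda>t. D (t *\<^sub>R v))) (at 0)"
    by (rule has_derivative_in_compose)
  then show ?thesis
    using linear_cmul[OF has_derivative_linear[OF assms(1)]]
    by (simp add: has_vector_derivative_def)
qed

text \<open>The difference quotients lie in \<open>E\<close>, and \<open>E\<close> is closed because
  the ambient space is finite-dimensional.\<close>

lemma vector_derivative_in_subspace:
  fixes E :: "'e::euclidean_space set"
  assumes E: "subspace E" and f: "(f has_vector_derivative w) (at a)"
    and ev: "\<forall>\<^sub>F t in at a. f t \<in> E" and a: "f a \<in> E"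
  shows "w \<in> E"
proof -
  have *: "((\<lambda>t. norm (f t - f a - (t - a) *\<^sub>R w) / norm (t - a)) \<longlongrightarrow> 0) (at a)"
    using f by (simp add: has_vector_derivative_def has_derivative_iff_norm)
  have "norm (f t - f a - (t - a) *\<^sub>R w) / norm (t - a) =
      norm (inverse (t - a) *\<^sub>R (f t - f a) - w)" if "t \<noteq> a" for t
  proof -
    have "inverse (t - a) *\<^sub>R (f t - f a) - w = inverse (t - a) *\<^sub>R (f t - f a - (t - a) *\<^sub>R w)"
      using that by (simp add: scaleR_right_diff_distrib)
    then show ?thesis
      by (simp add: divide_inverse_commute)
  qed
  then have "\<forall>\<^sub>F t in at a. norm (f t - f a - (t - a) *\<^sub>R w) / norm (t - a) =
      norm (inverse (t - a) *\<^sub>R (f t - f a) - w)"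
    by (simp add: eventually_at_filter)
  with * have "((\<lambda>t. norm (inverse (t - a) *\<^sub>R (f t - f a) - w)) \<longlongrightarrow> 0) (at a)"
    by (rule Lim_transform_eventually)
  then have lim: "((\<lambda>t. inverse (t - a) *\<^sub>R (f t - f a)) \<longlongrightarrow> w) (at a)"
    by (rule LIM_zero_cancel[OF tendsto_norm_zero_cancel])
  from ev have "\<forall>\<^sub>F t in at a. inverse (t - a) *\<^sub>R (f t - f a) \<in> E"
    by eventually_elim (intro subspace_scale[OF E] subspace_diff[OF E] a)
  from Lim_in_closed_set[OF closed_subspace[OF E] this _ lim] show ?thesis
    by simp
qed

lemma has_derivative_vec_iff:
  fixes f :: "'x::real_normed_vector \<Rightarrow> 'e::euclidean_space ^ 'n"
  shows "(f has_derivative D) (at x within S) \<longleftrightarrow>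
    (\<forall>k. ((\<lambda>y. f y $ k) has_derivative (\<lambda>v. D v $ k)) (at x within S))"
proof
  assume "(f has_derivative D) (at x within S)"
  then show "\<forall>k. ((\<lambda>y. f y $ k) has_derivative (\<lambda>v. D v $ k)) (at x within S)"
    using bounded_linear.has_derivative[OF bounded_linear_vec_nth] by blast
next
  assume *: "\<forall>k. ((\<lambda>y. f y $ k) has_derivative (\<lambda>v. D v $ k)) (at x within S)"
  show "(f has_derivative D) (at x within S)"
    unfolding has_derivative_componentwise_within[of f]
    using * by (auto simp: Basis_vec_def inner_axis intro!: has_derivative_inner_left)
qed

text \<open>The local consequences of \<^const>\<open>smooth_manifold\<close> that the calculus below rests on. They
  pass to products without any appeal to the separation and countability axioms.\<close>

definition model_nhds :: "('a, 'e::euclidean_space) manifold \<Rightarrow> 'a \<Rightarrow> 'e filter" where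
  "model_nhds M p = inf (nhds (chart M p p)) (principal (model M))"

definition regular_chart :: "('a, 'e::euclidean_space) manifold \<Rightarrow> 'a \<Rightarrow> bool" where
  "regular_chart M p \<longleftrightarrow>
     subspace (model M) \<and> p \<in> chart_dom M p \<and> inj_on (chart M p) (chart_dom M p) \<and>
     chart_dom M p \<subseteq> points M \<and> chart M p ` chart_dom M p \<subseteq> model M \<and>
     (\<forall>\<^sub>F x in nhdsin (top_of M) p. x \<in> chart_dom M p) \<and>
     filterlim (chart M p) (nhds (chart M p p)) (nhdsin (top_of M) p) \<and>
     (\<forall>\<^sub>F x in model_nhds M p. x \<in> chart M p ` chart_dom M p) \<and>
     filterlim (chart_inv M p) (nhdsin (top_of M) p) (model_nhds M p)"

lemma filterlim_model_nhds:
  "filterlim f (model_nhds M p) F \<longleftrightarrow> (f \<longlongrightarrow> chart M p p) F \<and> (\<forall>\<^sub>F x in F. f x \<in> model M)"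
  by (simp add: model_nhds_def filterlim_inf filterlim_principal)

lemma model_nhds_self:
  "((\<lambda>x. x) \<longlongrightarrow> chart M p p) (model_nhds M p)" "\<forall>\<^sub>F x in model_nhds M p. x \<in> model M"
  using filterlim_ident[of "model_nhds M p"] unfolding filterlim_model_nhds by auto

text \<open>\<open>model_nhds\<close> keeps the centre and the filter on the left is punctured,
  hence only an inequality.\<close>

lemma at_model_le: "at (chart M p p) within model M \<le> model_nhds M p"
  unfolding at_within_def model_nhds_def by (intro inf_mono) auto

lemma chart_inv_chart:
  "regular_chart M p \<Longrightarrow> x \<in> chart_dom M p \<Longrightarrow> chart_inv M p (chart M p x) = x"
  by (simp add: regular_chart_def chart_inv_def)

lemma chart_inv_chart_self: "regular_chart M p \<Longrightarrow> chart_inv M p (chart M p p) = p"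
  by (rule chart_inv_chart) (simp_all add: regular_chart_def)

lemma chart_in_model: "regular_chart M p \<Longrightarrow> x \<in> chart_dom M p \<Longrightarrow> chart M p x \<in> model M"
  by (auto simp: regular_chart_def)

lemma chart_dom_points: "regular_chart M p \<Longrightarrow> x \<in> chart_dom M p \<Longrightarrow> x \<in> points M"
  by (auto simp: regular_chart_def)

lemma chart_self_in_model: "regular_chart M p \<Longrightarrow> chart M p p \<in> model M"
  by (auto simp: regular_chart_def)

lemma regular_chart_subspace: "regular_chart M p \<Longrightarrow> subspace (model M)"
  by (simp add: regular_chart_def)

lemma regular_chart_points: "regular_chart M p \<Longrightarrow> p \<in> points M"
  by (auto simp: regular_chart_def)

lemma chart_inv_in_dom: "x \<in> chart M p ` chart_dom M p \<Longrightarrow> chart_inv M p x \<in> chart_dom M p"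
  by (simp add: chart_inv_def inv_into_into)

lemma chart_chart_inv: "x \<in> chart M p ` chart_dom M p \<Longrightarrow> chart M p (chart_inv M p x) = x"
  by (simp add: chart_inv_def f_inv_into_f)

lemma eventually_chart_inv_in_dom:
  assumes "regular_chart M p"
  shows "\<forall>\<^sub>F x in at (chart M p p) within model M.
    chart_inv M p x \<in> chart_dom M p \<and> chart M p (chart_inv M p x) = x"
proof -
  have "\<forall>\<^sub>F x in at (chart M p p) within model M. x \<in> chart M p ` chart_dom M p"
    using assms by (auto simp: regular_chart_def intro: filter_leD[OF at_model_le])
  then show ?thesis
    by eventually_elim (simp add: chart_inv_in_dom chart_chart_inv)
qed

lemma regular_chartI:
  assumes sub: "subspace (model M)" and pD: "p \<in> chart_dom M p"
    and D: "openin (top_of M) (chart_dom M p)"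
    and im: "openin (top_of_set (model M)) (chart M p ` chart_dom M p)"
    and hom: "homeomorphic_map (subtopology (top_of M) (chart_dom M p))
      (top_of_set (chart M p ` chart_dom M p)) (chart M p)"
  shows "regular_chart M p"
proof -
  let ?D = "chart_dom M p" and ?h = "chart M p"
  have DT: "?D \<subseteq> points M"
    using D by (rule openin_subset)
  then have top: "topspace (subtopology (top_of M) ?D) = ?D"
    by auto
  have inj: "inj_on ?h ?D"
    using hom top by (metis homeomorphic_imp_injective_map)
  have evD: "\<forall>\<^sub>F x in nhdsin (top_of M) p. x \<in> ?D"
    using D pD unfolding eventually_nhdsin by blast
  have cont: "continuous_map (subtopology (top_of M) ?D) euclidean ?h"
    using homeomorphic_imp_continuous_map[OF hom] by (rule continuous_map_into_fulltopology)
  \<comment> \<open>The identity converges to \<open>p\<close> along its own neighbourhood filter;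
    composing with a continuous map turns continuity into a filter limit.\<close>
  have "limitin (top_of M) (\<lambda>x. x) p (nhdsin (top_of M) p)"
    using DT pD by (auto simp: limitin_iff_filterlim filterlim_ident)
  then have "limitin (subtopology (top_of M) ?D) (\<lambda>x. x) p (nhdsin (top_of M) p)"
    using pD evD by (simp add: limitin_subtopology)
  from continuous_map_limit[OF cont this]
  have lim: "filterlim ?h (nhds (?h p)) (nhdsin (top_of M) p)"
    by (simp add: o_def)
  have ev: "\<forall>\<^sub>F x in model_nhds M p. x \<in> ?h ` ?D"
    using im pD unfolding model_nhds_def eventually_inf_principal eventually_nhds
    by (auto simp: openin_open)
  \<comment> \<open>The continuous inverse supplied by the homeomorphism agrees on the chart image
    with \<open>chart_inv\<close>, which is an \<open>inv_into\<close>, so continuity carries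
    over.\<close>
  obtain g where g: "homeomorphic_maps (subtopology (top_of M) ?D) (top_of_set (?h ` ?D)) ?h g"
    using hom homeomorphic_map_maps by blast
  have "g x = chart_inv M p x" if x: "x \<in> ?h ` ?D" for x
  proof -
    from x obtain y where y: "y \<in> ?D" "x = ?h y"
      by blast
    then have "g x = y"
      using g top by (auto simp: homeomorphic_maps_def)
    with y inj show ?thesis
      by (simp add: chart_inv_def)
  qed
  with g have "continuous_map (top_of_set (?h ` ?D)) (subtopology (top_of M) ?D) (chart_inv M p)"
    by (auto simp: homeomorphic_maps_def elim!: continuous_map_eq)
  moreover have "limitin (top_of_set (?h ` ?D)) (\<lambda>x. x) (?h p) (model_nhds M p)"
    using ev pD by (simp add: limitin_subtopology model_nhds_def tendsto_def eventually_inf_principal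
        eventually_nhds) blast
  ultimately have "limitin (subtopology (top_of M) ?D) (chart_inv M p \<circ> (\<lambda>x. x))
      (chart_inv M p (?h p)) (model_nhds M p)"
    by (rule continuous_map_limit)
  moreover have "chart_inv M p (?h p) = p"
    using inj pD by (simp add: chart_inv_def)
  ultimately have "limitin (top_of M) (chart_inv M p) p (model_nhds M p)"
    by (simp add: limitin_subtopology o_def)
  then have "filterlim (chart_inv M p) (nhdsin (top_of M) p) (model_nhds M p)"
    by (simp add: limitin_iff_filterlim)
  with sub pD inj evD lim ev DT openin_imp_subset[OF im] show ?thesis
    by (simp add: regular_chart_def)
qed

lemma regular_chart_smooth_manifold:
  "smooth_manifold M \<Longrightarrow> p \<in> points M \<Longrightarrow> regular_chart M p"
  by (rule regular_chartI) (auto simp: smooth_manifold_def)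

section \<open>Charts of product manifolds\<close>

lemma prod_manifold2_simps [simp]:
  "top_of (prod_manifold2 M N) = prod_topology (top_of M) (top_of N)"
  "model (prod_manifold2 M N) = model M \<times> model N"
  "chart_dom (prod_manifold2 M N) (p, q) = chart_dom M p \<times> chart_dom N q"
  "chart (prod_manifold2 M N) (p, q) = (\<lambda>x. (chart M p (fst x), chart N q (snd x)))"
  by (auto simp: prod_manifold2_def split: prod.splits)

lemma prod_manifold_simps [simp]:
  "top_of (prod_manifold M) = product_topology (\<lambda>k. top_of (M k)) UNIV"
  "model (prod_manifold M) = {x. \<forall>k. x $ k \<in> model (M k)}"
  "chart_dom (prod_manifold M) p = {x. \<forall>k. x k \<in> chart_dom (M k) (p k)}"
  "chart (prod_manifold M) p = (\<lambda>x. \<chi> k. chart (M k) (p k) (x k))"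
  by (auto simp: prod_manifold_def)

lemma limitin_self: "p \<in> topspace X \<Longrightarrow> limitin X (\<lambda>x. x) p (nhdsin X p)"
  by (simp add: limitin_iff_filterlim filterlim_ident)

lemma regular_chart_prod_manifold2:
  assumes M: "regular_chart M p" and N: "regular_chart N q"
  shows "regular_chart (prod_manifold2 M N) (p, q)"
proof -
  let ?P = "prod_manifold2 M N"
  have pq: "(p, q) \<in> points ?P"
    using regular_chart_points[OF M] regular_chart_points[OF N] by simp
  have fst: "filterlim fst (nhdsin (top_of M) p) (nhdsin (top_of ?P) (p, q))"
    and snd: "filterlim snd (nhdsin (top_of N) q) (nhdsin (top_of ?P) (p, q))"
    using limitin_self[OF pq] unfolding prod_manifold2_simps(1) limitin_pairwise
    by (simp_all add: limitin_iff_filterlim o_def)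
  have fst': "filterlim fst (model_nhds M p) (model_nhds ?P (p, q))"
    and snd': "filterlim snd (model_nhds N q) (model_nhds ?P (p, q))"
    using tendsto_fst[OF model_nhds_self(1)[of ?P "(p, q)"]] tendsto_snd[OF model_nhds_self(1)[of ?P "(p, q)"]]
      model_nhds_self(2)[of ?P "(p, q)"]
    unfolding filterlim_model_nhds by (auto elim!: eventually_mono)
  have inj: "inj_on (chart ?P (p, q)) (chart_dom ?P (p, q))"
    using M N by (auto simp: regular_chart_def inj_on_def)
  have "\<forall>\<^sub>F x in nhdsin (top_of ?P) (p, q). fst x \<in> chart_dom M p"
    "\<forall>\<^sub>F x in nhdsin (top_of ?P) (p, q). snd x \<in> chart_dom N q"
    using M N fst snd unfolding filterlim_iff regular_chart_def by blast+
  then have dom: "\<forall>\<^sub>F x in nhdsin (top_of ?P) (p, q). x \<in> chart_dom ?P (p, q)"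
    by eventually_elim (auto simp: mem_Times_iff)
  have lim: "filterlim (chart ?P (p, q)) (nhds (chart ?P (p, q) (p, q))) (nhdsin (top_of ?P) (p, q))"
    using M N fst snd unfolding regular_chart_def
    by (simp, intro tendsto_Pair; force intro: filterlim_compose[where g = "chart _ _"])
  have "\<forall>\<^sub>F x in model_nhds ?P (p, q). fst x \<in> chart M p ` chart_dom M p"
    "\<forall>\<^sub>F x in model_nhds ?P (p, q). snd x \<in> chart N q ` chart_dom N q"
    using M N fst' snd' unfolding filterlim_iff regular_chart_def by blast+
  \<comment> \<open>The inverse of the product chart is again an \<open>inv_into\<close>, so it
    splits into coordinates only on the chart image. Near the centre this is enough.\<close>
  then have ev: "\<forall>\<^sub>F x in model_nhds ?P (p, q). x \<in> chart ?P (p, q) ` chart_dom ?P (p, q) \<and>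
      chart_inv ?P (p, q) x = (chart_inv M p (fst x), chart_inv N q (snd x))"
  proof eventually_elim
    case (elim x)
    then obtain y z where yz: "y \<in> chart_dom M p" "z \<in> chart_dom N q" "x = (chart M p y, chart N q z)"
      by (metis imageE prod.collapse)
    then have "x = chart ?P (p, q) (y, z)" "(y, z) \<in> chart_dom ?P (p, q)"
      by simp_all
    moreover from this inj have "chart_inv ?P (p, q) x = (y, z)"
      unfolding chart_inv_def by (metis inv_into_f_f)
    moreover have "chart_inv M p (fst x) = y" "chart_inv N q (snd x) = z"
      using M N yz by (simp_all add: chart_inv_chart)
    ultimately show ?case
      by (intro conjI image_eqI[of x "chart ?P (p, q)" "(y, z)"]) simp_all
  qed
  have lim_inv: "filterlim (\<lambda>x. chart_inv M p (fst x)) (nhdsin (top_of M) p) (model_nhds ?P (p, q))"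
    "filterlim (\<lambda>x. chart_inv N q (snd x)) (nhdsin (top_of N) q) (model_nhds ?P (p, q))"
    using M N unfolding regular_chart_def
    by (auto intro: filterlim_compose[OF _ fst'] filterlim_compose[OF _ snd'])
  have "limitin (top_of ?P) (\<lambda>x. (chart_inv M p (fst x), chart_inv N q (snd x))) (p, q)
      (model_nhds ?P (p, q))"
    using regular_chart_points[OF M] regular_chart_points[OF N] lim_inv
    unfolding prod_manifold2_simps(1) limitin_pairwise by (simp add: o_def limitin_iff_filterlim)
  then have "limitin (top_of ?P) (chart_inv ?P (p, q)) (p, q) (model_nhds ?P (p, q))"
    by (rule limitin_transform_eventually[rotated]) (use ev in \<open>auto elim: eventually_mono\<close>)
  then have "filterlim (chart_inv ?P (p, q)) (nhdsin (top_of ?P) (p, q)) (model_nhds ?P (p, q))"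
    by (simp add: limitin_iff_filterlim)
  moreover have "subspace (model ?P)"
    using M N by (simp add: regular_chart_def subspace_Times)
  moreover have "\<forall>\<^sub>F x in model_nhds ?P (p, q). x \<in> chart ?P (p, q) ` chart_dom ?P (p, q)"
    using ev by (rule eventually_mono) blast
  moreover have "(p, q) \<in> chart_dom ?P (p, q)" "chart_dom ?P (p, q) \<subseteq> points ?P"
    "chart ?P (p, q) ` chart_dom ?P (p, q) \<subseteq> model ?P"
    using M N by (auto simp: regular_chart_def)
  ultimately show ?thesis
    using inj dom lim unfolding regular_chart_def by blast
qed

lemma regular_chart_prod_manifold:
  assumes M: "\<And>k. regular_chart (M k) (p k)"
  shows "regular_chart (prod_manifold M) p"
proof -
  let ?P = "prod_manifold M"
  have p: "p \<in> points ?P"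
    using regular_chart_points[OF M] by (simp add: topspace_product_topology PiE_UNIV_domain)
  have proj: "filterlim (\<lambda>x. x k) (nhdsin (top_of (M k)) (p k)) (nhdsin (top_of ?P) p)" for k
    using limitin_self[OF p] unfolding prod_manifold_simps(1) limitin_componentwise
    by (simp add: limitin_iff_filterlim)
  have proj': "filterlim (\<lambda>x. x $ k) (model_nhds (M k) (p k)) (model_nhds ?P p)" for k
    using tendsto_vec_nth[OF model_nhds_self(1)[of ?P p], of k] model_nhds_self(2)[of ?P p]
    unfolding filterlim_model_nhds by (auto elim!: eventually_mono)
  have inj: "inj_on (chart ?P p) (chart_dom ?P p)"
  proof (rule inj_onI, rule ext)
    fix x y k
    assume "x \<in> chart_dom ?P p" "y \<in> chart_dom ?P p" "chart ?P p x = chart ?P p y"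
    then show "x k = y k"
      using M[of k] by (auto simp: regular_chart_def vec_eq_iff dest: inj_onD)
  qed
  have "\<forall>\<^sub>F x in nhdsin (top_of ?P) p. x k \<in> chart_dom (M k) (p k)" for k
    using M proj unfolding filterlim_iff regular_chart_def by blast
  then have dom: "\<forall>\<^sub>F x in nhdsin (top_of ?P) p. x \<in> chart_dom ?P p"
    by (simp add: eventually_all_finite)
  have lim: "filterlim (chart ?P p) (nhds (chart ?P p p)) (nhdsin (top_of ?P) p)"
    using M proj unfolding regular_chart_def
    by (simp, intro tendsto_vec_lambda; force intro: filterlim_compose[where g = "chart _ _"])
  have "\<forall>\<^sub>F x in model_nhds ?P p. x $ k \<in> chart (M k) (p k) ` chart_dom (M k) (p k)" for k
    using M proj' unfolding filterlim_iff regular_chart_def by blast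
  then have "\<forall>\<^sub>F x in model_nhds ?P p. \<forall>k. x $ k \<in> chart (M k) (p k) ` chart_dom (M k) (p k)"
    by (simp add: eventually_all_finite)
  then have ev: "\<forall>\<^sub>F x in model_nhds ?P p. x \<in> chart ?P p ` chart_dom ?P p \<and>
      chart_inv ?P p x = (\<lambda>k. chart_inv (M k) (p k) (x $ k))"
  proof eventually_elim
    case (elim x)
    define y where "y k = chart_inv (M k) (p k) (x $ k)" for k
    have "x = chart ?P p y" "y \<in> chart_dom ?P p"
      using elim by (simp_all add: y_def vec_eq_iff chart_chart_inv chart_inv_in_dom)
    moreover from this inj have "chart_inv ?P p x = y"
      unfolding chart_inv_def by (metis inv_into_f_f)
    moreover have "y = (\<lambda>k. chart_inv (M k) (p k) (x $ k))"
      by (simp add: y_def fun_eq_iff)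
    ultimately show ?case
      by (intro conjI image_eqI[of x "chart ?P p" y]) simp_all
  qed
  have "limitin (top_of (M k)) (\<lambda>x. chart_inv (M k) (p k) (x $ k)) (p k) (model_nhds ?P p)" for k
    using M[of k] regular_chart_points[OF M, of k] unfolding regular_chart_def
    by (auto simp: limitin_iff_filterlim intro: filterlim_compose[OF _ proj'[of k]])
  \<comment> \<open>Componentwise convergence in a product topology also requires the values to lie
    eventually in the space itself.\<close>
  moreover have "\<forall>\<^sub>F x in model_nhds ?P p. (\<lambda>k. chart_inv (M k) (p k) (x $ k)) \<in> points ?P"
    using ev
  proof eventually_elim
    case (elim x)
    then have "chart_inv ?P p x \<in> chart_dom ?P p"
      by (intro chart_inv_in_dom) blast
    moreover have "chart_dom ?P p \<subseteq> points ?P"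
      using M by (auto simp: regular_chart_def)
    moreover have "(\<lambda>k. chart_inv (M k) (p k) (x $ k)) = chart_inv ?P p x"
      using elim by simp
    ultimately show ?case
      by (metis subsetD)
  qed
  ultimately have "limitin (top_of ?P) (\<lambda>x k. chart_inv (M k) (p k) (x $ k)) p (model_nhds ?P p)"
    by (simp add: limitin_componentwise)
  then have "limitin (top_of ?P) (chart_inv ?P p) p (model_nhds ?P p)"
    by (rule limitin_transform_eventually[rotated]) (use ev in \<open>auto elim: eventually_mono\<close>)
  then have "filterlim (chart_inv ?P p) (nhdsin (top_of ?P) p) (model_nhds ?P p)"
    by (simp add: limitin_iff_filterlim)
  moreover have "subspace (model ?P)"
    using M by (simp add: regular_chart_def subspace_def)
  moreover have "\<forall>\<^sub>F x in model_nhds ?P p. x \<in> chart ?P p ` chart_dom ?P p"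
    using ev by (rule eventually_mono) blast
  moreover have "p \<in> chart_dom ?P p" "chart_dom ?P p \<subseteq> points ?P"
    "chart ?P p ` chart_dom ?P p \<subseteq> model ?P"
    using M chart_dom_points[OF M] chart_in_model[OF M] by (auto simp: regular_chart_def PiE_UNIV_domain)
  ultimately show ?thesis
    using inj dom lim unfolding regular_chart_def by blast
qed

section \<open>Differentials in charts\<close>

text \<open>One notion for curves (\<open>S\<close> an interval) and for coordinate forms of maps
  (\<open>S\<close> a model space). The limit clause is essential: \<open>chart\<close> is a total
  function with unspecified values off its domain, so its derivative alone does not keep
  \<open>f\<close> near \<open>f x\<close>.\<close>

definition has_chart_derivative ::
    "('a, 'e::euclidean_space) manifold \<Rightarrow> ('x::real_normed_vector \<Rightarrow> 'a) \<Rightarrow> 'x \<Rightarrow> 'x set \<Rightarrow> ('x \<Rightarrow> 'e) \<Rightarrow> bool" where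
  "has_chart_derivative N f x S D \<longleftrightarrow>
     limitin (top_of N) f (f x) (at x within S) \<and>
     ((\<lambda>y. chart N (f x) (f y)) has_derivative D) (at x within S)"

definition differentiable_map_at ::
    "('a, 'e::euclidean_space) manifold \<Rightarrow> ('b, 'f::euclidean_space) manifold \<Rightarrow> ('a \<Rightarrow> 'b) \<Rightarrow> 'a \<Rightarrow> bool" where
  "differentiable_map_at M N F p \<longleftrightarrow>
     (\<exists>D. has_chart_derivative N (\<lambda>x. F (chart_inv M p x)) (chart M p p) (model M) D)"

lemma has_chart_derivative_linear: "has_chart_derivative N f x S D \<Longrightarrow> linear D"
  by (auto simp: has_chart_derivative_def intro: has_derivative_linear)

lemma has_chart_derivative_points: "has_chart_derivative N f x S D \<Longrightarrow> f x \<in> points N"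
  by (auto simp: has_chart_derivative_def dest: limitin_topspace)

lemma has_chart_derivative_unique:
  assumes "has_chart_derivative N f x E D" "has_chart_derivative N f x E D'"
    and E: "subspace E" "x \<in> E" "v \<in> E"
  shows "D v = D' v"
proof -
  have "x + t *\<^sub>R v \<in> E" for t
    using E by (intro subspace_add subspace_scale)
  then show ?thesis
    using assms unfolding has_chart_derivative_def
    by (metis has_derivative_line vector_derivative_unique_at)
qed

lemma has_chart_derivative_cong:
  assumes "has_chart_derivative N f x S D" "x \<in> S"
    and "\<forall>\<^sub>F y in at x within S. f y = f' y" "f x = f' x"
  shows "has_chart_derivative N f' x S D"
  using assms unfolding has_chart_derivative_def
  by (auto elim!: limitin_transform_eventually[rotated] has_derivative_transform_eventually eventually_mono)

lemma has_chart_derivative_eventually_dom: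
  assumes "regular_chart N (f x)" "has_chart_derivative N f x S D"
  shows "\<forall>\<^sub>F y in at x within S. f y \<in> chart_dom N (f x)"
  using assms by (auto simp: has_chart_derivative_def regular_chart_def limitin_iff_filterlim filterlim_iff)

lemma has_chart_derivative_in_model:
  assumes N: "regular_chart N (f x)" and f: "has_chart_derivative N f x E D"
    and E: "subspace E" "x \<in> E" "v \<in> E"
  shows "D v \<in> model N"
proof -
  have line: "x + t *\<^sub>R v \<in> E" for t
    using E by (intro subspace_add subspace_scale)
  have "((\<lambda>t. chart N (f x) (f (x + t *\<^sub>R v))) has_vector_derivative D v) (at 0)"
    using f line unfolding has_chart_derivative_def by (auto intro: has_derivative_line)
  moreover have "\<forall>\<^sub>F t in at 0. chart N (f x) (f (x + t *\<^sub>R v)) \<in> model N"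
  \<comment> \<open>For \<open>v = 0\<close> the line stays at \<open>x\<close> and does not
    converge in the punctured filter, so this case is separate.\<close>
  proof (cases "v = 0")
    case True
    with chart_self_in_model[OF N] show ?thesis
      by simp
  next
    case False
    have "\<forall>\<^sub>F y in at x within E. chart N (f x) (f y) \<in> model N"
      using has_chart_derivative_eventually_dom[OF N f]
      by eventually_elim (rule chart_in_model[OF N])
    moreover have "filterlim (\<lambda>t. x + t *\<^sub>R v) (at x within E) (at (0::real))"
      unfolding filterlim_at
    proof
      show "\<forall>\<^sub>F t in at (0::real). x + t *\<^sub>R v \<in> E \<and> x + t *\<^sub>R v \<noteq> x"
        using line False by (auto simp: eventually_at_filter)
      have "((\<lambda>t. x + t *\<^sub>R v) \<longlongrightarrow> x + 0 *\<^sub>R v) (at (0::real))"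
        by (intro tendsto_intros)
      then show "((\<lambda>t. x + t *\<^sub>R v) \<longlongrightarrow> x) (at (0::real))"
        by simp
    qed
    ultimately show ?thesis
      by (rule eventually_compose_filterlim)
  qed
  moreover have "chart N (f x) (f (x + 0 *\<^sub>R v)) \<in> model N"
    using chart_self_in_model[OF N] by simp
  ultimately show ?thesis
    by (rule vector_derivative_in_subspace[OF regular_chart_subspace[OF N]])
qed

text \<open>\<open>frechet_derivative\<close> chooses some derivative, so the existence of one
  suffices. Its values are determined only on the model space, hence the condition on
  \<open>v\<close> in later equations.\<close>

lemma has_chart_derivative_differential:
  assumes "regular_chart M p" "differentiable_map_at M N F p"
  shows "has_chart_derivative N (\<lambda>x. F (chart_inv M p x)) (chart M p p) (model M) (differential M N F p)"
proof -
  from assms obtain D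
    where D: "has_chart_derivative N (\<lambda>x. F (chart_inv M p x)) (chart M p p) (model M) D"
    by (auto simp: differentiable_map_at_def)
  then have "(chart N (F p) \<circ> F \<circ> chart_inv M p) differentiable (at (chart M p p) within model M)"
    using assms(1) by (auto simp: has_chart_derivative_def chart_inv_chart_self o_def intro: differentiableI)
  with D assms(1) show ?thesis
    by (simp add: frechet_derivative_works differential_def has_chart_derivative_def
        chart_inv_chart_self o_def)
qed

lemma differential_eqI:
  assumes M: "regular_chart M p"
    and D: "has_chart_derivative N (\<lambda>x. F (chart_inv M p x)) (chart M p p) (model M) D"
  shows "differentiable_map_at M N F p" and "v \<in> model M \<Longrightarrow> differential M N F p v = D v"
proof -
  show F: "differentiable_map_at M N F p"
    using D by (auto simp: differentiable_map_at_def)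
  show "differential M N F p v = D v" if "v \<in> model M"
    using has_chart_derivative_differential[OF M F] D regular_chart_subspace[OF M]
      chart_self_in_model[OF M] that
    by (rule has_chart_derivative_unique)
qed

lemma linear_differential:
  "regular_chart M p \<Longrightarrow> differentiable_map_at M N F p \<Longrightarrow> linear (differential M N F p)"
  by (rule has_chart_derivative_linear[OF has_chart_derivative_differential])

lemma differential_in_model:
  assumes M: "regular_chart M p" and N: "regular_chart N (F p)"
    and F: "differentiable_map_at M N F p" and v: "v \<in> model M"
  shows "differential M N F p v \<in> model N"
  using has_chart_derivative_in_model[OF _ has_chart_derivative_differential[OF M F]]
    regular_chart_subspace[OF M] chart_self_in_model[OF M] v N
  by (simp add: chart_inv_chart_self[OF M])

text \<open>Continuity at \<open>p\<close>: the limit in coordinates is pulled back along the chart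
  at \<open>p\<close>.\<close>

lemma differentiable_map_at_limitin:
  assumes M: "regular_chart M p" and F: "differentiable_map_at M N F p"
  shows "limitin (top_of N) F (F p) (nhdsin (top_of M) p)"
  unfolding limitin_def
proof (intro conjI allI impI)
  have *: "limitin (top_of N) (\<lambda>x. F (chart_inv M p x)) (F p) (at (chart M p p) within model M)"
    using has_chart_derivative_differential[OF M F]
    by (simp add: has_chart_derivative_def chart_inv_chart_self[OF M])
  then show "F p \<in> points N"
    by (rule limitin_topspace)
  fix U assume U: "openin (top_of N) U \<and> F p \<in> U"
  with * have "\<forall>\<^sub>F x in at (chart M p p) within model M. F (chart_inv M p x) \<in> U"
    by (auto intro: limitinD)
  \<comment> \<open>The centre may be added to the punctured neighbourhood because
    \<open>F p\<close> lies in \<open>U\<close>.\<close>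
  then have "\<forall>\<^sub>F x in model_nhds M p. F (chart_inv M p x) \<in> U"
    unfolding eventually_at_filter model_nhds_def eventually_inf_principal
    by (rule eventually_mono) (use U in \<open>auto simp: chart_inv_chart_self[OF M]\<close>)
  moreover have "filterlim (chart M p) (model_nhds M p) (nhdsin (top_of M) p)"
    unfolding filterlim_model_nhds
    using M by (auto simp: regular_chart_def elim!: eventually_mono)
  ultimately have "\<forall>\<^sub>F y in nhdsin (top_of M) p. F (chart_inv M p (chart M p y)) \<in> U"
    by (rule eventually_compose_filterlim)
  moreover have "\<forall>\<^sub>F y in nhdsin (top_of M) p. y \<in> chart_dom M p"
    using M by (simp add: regular_chart_def)
  ultimately show "\<forall>\<^sub>F y in nhdsin (top_of M) p. F y \<in> U"
    by eventually_elim (simp add: chart_inv_chart[OF M])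
qed

lemma has_chart_derivative_compose:
  assumes M: "regular_chart M (f x)" and f: "has_chart_derivative M f x S D"
    and F: "differentiable_map_at M N F (f x)" and x: "x \<in> S"
  shows "has_chart_derivative N (\<lambda>y. F (f y)) x S (\<lambda>v. differential M N F (f x) (D v))"
  unfolding has_chart_derivative_def
proof
  \<comment> \<open>On \<open>?S\<close> the chart at \<open>f x\<close> and its inverse cancel, so
    the Euclidean chain rule applies; near \<open>x\<close> the set \<open>?S\<close> is all of
    \<open>S\<close>.\<close>
  let ?p = "f x" and ?S = "{y \<in> S. f y \<in> chart_dom M (f x)}"
  have lim: "limitin (top_of M) f (f x) (at x within S)"
    and der: "((\<lambda>y. chart M (f x) (f y)) has_derivative D) (at x within S)"
    using f by (auto simp: has_chart_derivative_def)
  show "limitin (top_of N) (\<lambda>y. F (f y)) (F (f x)) (at x within S)"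
    using differentiable_map_at_limitin[OF M F] lim
    by (auto simp: limitin_iff_filterlim[of "top_of M"] intro: limitin_filterlim_compose)
  have "\<forall>\<^sub>F y in at x within S. y \<in> ?S"
    using has_chart_derivative_eventually_dom[OF M f]
    by (auto simp: eventually_at_filter elim!: eventually_mono)
  then have at: "at x within ?S = at x within S"
    by (intro at_within_eqI) auto
  have "((\<lambda>x. chart N (F ?p) (F (chart_inv M ?p x))) has_derivative differential M N F ?p)
      (at (chart M ?p ?p) within model M)"
    using has_chart_derivative_differential[OF M F]
    by (simp add: has_chart_derivative_def chart_inv_chart_self[OF M])
  then have "((\<lambda>x. chart N (F ?p) (F (chart_inv M ?p x))) has_derivative differential M N F ?p)
      (at (chart M ?p (f x)) within (\<lambda>y. chart M ?p (f y)) ` ?S)"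
    by (rule has_derivative_subset) (auto simp: chart_in_model[OF M])
  with der have "((\<lambda>y. chart N (F ?p) (F (chart_inv M ?p (chart M ?p (f y))))) has_derivative
      (\<lambda>v. differential M N F ?p (D v))) (at x within ?S)"
    unfolding at[symmetric] by (rule has_derivative_in_compose)
  then show "((\<lambda>y. chart N (F (f x)) (F (f y))) has_derivative
      (\<lambda>v. differential M N F (f x) (D v))) (at x within S)"
    unfolding at[symmetric]
    by (rule has_derivative_transform_within[OF _ zero_less_one])
      (use x M in \<open>auto simp: chart_inv_chart regular_chart_def\<close>)
qed

lemma differentiable_map_at_compose:
  assumes M: "regular_chart M p" and N: "regular_chart N (F p)"
    and F: "differentiable_map_at M N F p" and H: "differentiable_map_at N P H (F p)"
  shows "differentiable_map_at M P (\<lambda>x. H (F x)) p"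
    and "v \<in> model M \<Longrightarrow>
      differential M P (\<lambda>x. H (F x)) p v = differential N P H (F p) (differential M N F p v)"
proof -
  have "has_chart_derivative P (\<lambda>x. H (F (chart_inv M p x))) (chart M p p) (model M)
      (\<lambda>v. differential N P H (F p) (differential M N F p v))"
    using has_chart_derivative_compose[OF _ has_chart_derivative_differential[OF M F]] N H
      chart_self_in_model[OF M] by (simp add: chart_inv_chart_self[OF M])
  from differential_eqI[OF M this]
  show "differentiable_map_at M P (\<lambda>x. H (F x)) p"
    and "v \<in> model M \<Longrightarrow>
      differential M P (\<lambda>x. H (F x)) p v = differential N P H (F p) (differential M N F p v)"
    by blast+
qed

text \<open>Agreement on the points suffices since \<open>chart_inv\<close> takes values there near
  the centre. Group laws, valid on carriers only, can thus be differentiated.\<close>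

lemma differentiable_map_at_cong:
  assumes M: "regular_chart M p" and F: "differentiable_map_at M N F p"
    and eq: "\<And>x. x \<in> points M \<Longrightarrow> F x = F' x"
  shows "differentiable_map_at M N F' p"
    and "v \<in> model M \<Longrightarrow> differential M N F' p v = differential M N F p v"
proof -
  have "\<forall>\<^sub>F x in at (chart M p p) within model M. F (chart_inv M p x) = F' (chart_inv M p x)"
    using eventually_chart_inv_in_dom[OF M]
    by eventually_elim (simp add: eq chart_dom_points[OF M])
  then have "has_chart_derivative N (\<lambda>x. F' (chart_inv M p x)) (chart M p p) (model M) (differential M N F p)"
    by (rule has_chart_derivative_cong[OF has_chart_derivative_differential[OF M F] chart_self_in_model[OF M]])
      (simp add: chart_inv_chart_self[OF M] eq regular_chart_points[OF M])
  from differential_eqI[OF M this]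
  show "differentiable_map_at M N F' p"
    and "v \<in> model M \<Longrightarrow> differential M N F' p v = differential M N F p v"
    by blast+
qed

lemma has_chart_derivative_const:
  "q \<in> points N \<Longrightarrow> has_chart_derivative N (\<lambda>_. q) x S (\<lambda>_. 0)"
  by (simp add: has_chart_derivative_def)

lemma differentiable_map_at_const:
  assumes "regular_chart M p" "q \<in> points N"
  shows "differentiable_map_at M N (\<lambda>_. q) p"
    and "v \<in> model M \<Longrightarrow> differential M N (\<lambda>_. q) p v = 0"
  using differential_eqI[OF assms(1) has_chart_derivative_const[OF assms(2)]] by blast+

text \<open>A chart read in itself is the identity. Fed into the rules for
  \<open>has_chart_derivative\<close>, this yields the differentials of the identity, projections
  and translations.\<close>

lemma has_chart_derivative_chart_inv:
  assumes M: "regular_chart M p"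
  shows "has_chart_derivative M (chart_inv M p) (chart M p p) (model M) (\<lambda>v. v)"
  unfolding has_chart_derivative_def chart_inv_chart_self[OF M]
proof
  show "limitin (top_of M) (chart_inv M p) p (at (chart M p p) within model M)"
    using M unfolding limitin_iff_filterlim
    by (auto simp: regular_chart_def intro: filterlim_mono[OF _ order_refl at_model_le])
  show "((\<lambda>y. chart M p (chart_inv M p y)) has_derivative (\<lambda>v. v)) (at (chart M p p) within model M)"
    by (rule has_derivative_transform_eventually[OF has_derivative_ident])
      (use eventually_chart_inv_in_dom[OF M] chart_self_in_model[OF M] in
        \<open>auto simp: chart_inv_chart_self[OF M] elim!: eventually_mono\<close>)
qed

lemma differential_id:
  assumes "regular_chart M p"
  shows "differentiable_map_at M M (\<lambda>x. x) p"
    and "v \<in> model M \<Longrightarrow> differential M M (\<lambda>x. x) p v = v"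
  using differential_eqI[OF assms, of M "\<lambda>x. x" "\<lambda>v. v"] has_chart_derivative_chart_inv[OF assms]
  by blast+

lemma has_chart_derivative_Pair:
  assumes "has_chart_derivative M f x S D" "has_chart_derivative N g x S E"
  shows "has_chart_derivative (prod_manifold2 M N) (\<lambda>y. (f y, g y)) x S (\<lambda>v. (D v, E v))"
  using assms unfolding has_chart_derivative_def prod_manifold2_simps limitin_pairwise
  by (auto simp: o_def intro: has_derivative_Pair)

lemma has_chart_derivative_component:
  assumes "has_chart_derivative (prod_manifold M) f x S D"
  shows "has_chart_derivative (M k) (\<lambda>y. f y k) x S (\<lambda>v. D v $ k)"
  using assms unfolding has_chart_derivative_def prod_manifold_simps limitin_componentwise has_derivative_vec_iff
  by auto

lemma has_chart_derivative_vecI: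
  assumes "\<And>k. has_chart_derivative (M k) (\<lambda>y. f y k) x S (\<lambda>v. D v $ k)"
  shows "has_chart_derivative (prod_manifold M) f x S D"
proof -
  have "\<forall>\<^sub>F y in at x within S. f y k \<in> points (M k)" for k
    using assms[of k] unfolding has_chart_derivative_def
    by (auto intro: limitinD dest: limitin_topspace)
  then show ?thesis
    using assms unfolding has_chart_derivative_def prod_manifold_simps limitin_componentwise has_derivative_vec_iff
    by (auto simp: PiE_UNIV_domain Pi_iff eventually_all_finite)
qed

lemma differential_component:
  assumes M: "\<And>k. regular_chart (M k) (p k)"
  shows "differentiable_map_at (prod_manifold M) (M k) (\<lambda>x. x k) p"
    and "v \<in> model (prod_manifold M) \<Longrightarrow> differential (prod_manifold M) (M k) (\<lambda>x. x k) p v = v $ k"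
proof -
  have P: "regular_chart (prod_manifold M) p"
    using M by (rule regular_chart_prod_manifold)
  from differential_eqI[OF P has_chart_derivative_component[OF has_chart_derivative_chart_inv[OF P]]]
  show "differentiable_map_at (prod_manifold M) (M k) (\<lambda>x. x k) p"
    and "v \<in> model (prod_manifold M) \<Longrightarrow> differential (prod_manifold M) (M k) (\<lambda>x. x k) p v = v $ k"
    by blast+
qed

lemma differentiable_map_at_vecI:
  assumes N: "regular_chart N p" and F: "\<And>k. differentiable_map_at N (M k) (\<lambda>x. F x k) p"
  shows "differentiable_map_at N (prod_manifold M) F p"
proof (rule differential_eqI(1)[OF N])
  show "has_chart_derivative (prod_manifold M) (\<lambda>x. F (chart_inv N p x)) (chart N p p) (model N)
      (\<lambda>v. \<chi> k. differential N (M k) (\<lambda>x. F x k) p v)"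
    by (rule has_chart_derivative_vecI) (simp add: has_chart_derivative_differential[OF N F])
qed

lemma smooth_map_differentiable:
  assumes F: "smooth_map M N F" and M: "regular_chart M p" and N: "regular_chart N (F p)"
  shows "differentiable_map_at M N F p"
proof -
  let ?S = "chart M p ` (chart_dom M p \<inter> F -` chart_dom N (F p))"
  have p: "p \<in> points M" "F p \<in> points N"
    using M N by (simp_all add: regular_chart_points)
  have cont: "continuous_map (top_of M) (top_of N) F"
    and smooth: "smooth_on (model M) ?S (chart N (F p) \<circ> F \<circ> chart_inv M p)"
    using F p by (auto simp: smooth_map_def)
  have "limitin (top_of M) (chart_inv M p) p (at (chart M p p) within model M)"
    using has_chart_derivative_chart_inv[OF M]
    by (simp add: has_chart_derivative_def chart_inv_chart_self[OF M])
  from continuous_map_limit[OF cont this]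
  have lim: "limitin (top_of N) (\<lambda>x. F (chart_inv M p x)) (F p) (at (chart M p p) within model M)"
    by (simp add: o_def)
  have "\<forall>\<^sub>F x in at (chart M p p) within model M. F (chart_inv M p x) \<in> chart_dom N (F p)"
    by (rule eventually_compose_filterlim[of "\<lambda>y. y \<in> chart_dom N (F p)"])
      (use lim N in \<open>auto simp: limitin_iff_filterlim regular_chart_def\<close>)
  with eventually_chart_inv_in_dom[OF M]
  have "\<forall>\<^sub>F x in at (chart M p p) within model M. x \<in> ?S"
    by eventually_elim (auto intro: rev_image_eqI)
  moreover have "?S \<subseteq> model M"
    by (auto simp: chart_in_model[OF M])
  \<comment> \<open>\<open>smooth_on\<close> differentiates within the coordinate image
    \<open>?S\<close>, \<open>differential\<close> within the model space; by continuity of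
    \<open>F\<close> the two filters agree.\<close>
  ultimately have at: "at (chart M p p) within ?S = at (chart M p p) within model M"
    by (rule at_within_eqI[rotated])
  have "chart M p p \<in> ?S"
    using M N by (auto simp: regular_chart_def)
  moreover from smooth have "C_k_on (Suc 0) (model M) ?S (chart N (F p) \<circ> F \<circ> chart_inv M p)"
    unfolding smooth_on_def by blast
  then have "\<forall>x\<in>?S. (chart N (F p) \<circ> F \<circ> chart_inv M p) differentiable (at x within ?S)"
    unfolding C_k_on.simps by (rule conjunct1)
  ultimately have "(chart N (F p) \<circ> F \<circ> chart_inv M p) differentiable (at (chart M p p) within model M)"
    unfolding at[symmetric] by (rule bspec[rotated])
  then obtain D where "((chart N (F p) \<circ> F \<circ> chart_inv M p) has_derivative D) (at (chart M p p) within model M)"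
    unfolding differentiable_def by blast
  with lim show ?thesis
    unfolding differentiable_map_at_def has_chart_derivative_def
    by (auto simp: o_def chart_inv_chart_self[OF M])
qed

section \<open>Lie groups\<close>

text \<open>\<open>N\<close> uses the single chart at \<open>p\<close> at every point, so the
  identity from \<open>M\<close> to \<open>N\<close> reads as a transition map. It converts
  velocities, which are measured in the chart at the moving point, to one fixed chart.\<close>

lemma smooth_manifold_recentre:
  fixes M :: "('a, 'e::euclidean_space) manifold" and p q :: 'a
  defines "N \<equiv> M\<lparr>chart_dom := \<lambda>_. chart_dom M p, chart := \<lambda>_. chart M p\<rparr>"
  assumes M: "smooth_manifold M" and p: "p \<in> points M" and q: "q \<in> chart_dom M p"
  shows "differentiable_map_at M N (\<lambda>x. x) q"
proof -
  have "smooth_map M N (\<lambda>x. x)"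
    using M p unfolding smooth_map_def smooth_manifold_def N_def
    by (simp add: Int_def vimage_def comp_def continuous_map_id[unfolded id_def])
  moreover have "regular_chart M q"
    using M p q by (meson chart_dom_points regular_chart_smooth_manifold)
  moreover have "regular_chart N q"
    using M p q by (intro regular_chartI) (auto simp: N_def smooth_manifold_def)
  ultimately show ?thesis
    by (rule smooth_map_differentiable)
qed

lemma has_velocity_iff:
  "has_velocity M I \<gamma> t w \<longleftrightarrow> w \<in> model M \<and> has_chart_derivative M \<gamma> t I (\<lambda>s. s *\<^sub>R w)"
  by (auto simp: has_velocity_def has_chart_derivative_def has_vector_derivative_def)

lemma has_velocity_points: "has_velocity M I \<gamma> t w \<Longrightarrow> \<gamma> t \<in> points M"
  by (auto simp: has_velocity_iff dest: has_chart_derivative_points)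

lemma has_velocity_cong:
  assumes "has_velocity M I \<gamma> t w" "t \<in> I" "\<And>s. s \<in> I \<Longrightarrow> \<gamma> s = \<gamma>' s"
  shows "has_velocity M I \<gamma>' t w"
proof -
  have "\<forall>\<^sub>F s in at t within I. \<gamma> s = \<gamma>' s"
    using assms(3) by (simp add: eventually_at_filter)
  then show ?thesis
    using assms has_chart_derivative_cong unfolding has_velocity_iff by blast
qed

lemma has_velocity_unique:
  assumes "has_velocity M I \<gamma> t w" "has_velocity M I \<gamma> t w'" "at t within I \<noteq> bot"
  shows "w = w'"
  using assms vector_derivative_unique_within unfolding has_velocity_def by blast

lemma has_velocity_compose:
  assumes M: "regular_chart M (\<gamma> t)" and \<gamma>: "has_velocity M I \<gamma> t w"
    and N: "regular_chart N (F (\<gamma> t))" and F: "differentiable_map_at M N F (\<gamma> t)" and t: "t \<in> I"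
  shows "has_velocity N I (\<lambda>s. F (\<gamma> s)) t (differential M N F (\<gamma> t) w)"
proof -
  have "has_chart_derivative N (\<lambda>s. F (\<gamma> s)) t I (\<lambda>s. differential M N F (\<gamma> t) (s *\<^sub>R w))"
    using \<gamma> unfolding has_velocity_iff
    by (intro has_chart_derivative_compose[where f = \<gamma> and x = t] M F t) auto
  moreover have "differential M N F (\<gamma> t) (s *\<^sub>R w) = s *\<^sub>R differential M N F (\<gamma> t) w" for s
    by (rule linear_cmul[OF linear_differential[OF M F]])
  moreover have "differential M N F (\<gamma> t) w \<in> model N"
    using \<gamma> by (auto simp: has_velocity_iff intro: differential_in_model[OF M N F])
  ultimately show ?thesis
    by (simp add: has_velocity_iff)
qed

lemma has_velocity_component:
  "has_velocity (prod_manifold M) I \<gamma> t w \<Longrightarrow> has_velocity (M k) I (\<lambda>s. \<gamma> s k) t (w $ k)"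
  unfolding has_velocity_iff using has_chart_derivative_component[of M \<gamma> t I "\<lambda>s. s *\<^sub>R w" k] by simp

text \<open>The curve is locally constant on a connected set: within one fixed chart its coordinates
  have derivative zero, and charts are injective.\<close>

lemma constant_if_zero_velocity:
  assumes M: "smooth_manifold M" and I: "is_interval I"
    and c: "\<And>t. t \<in> I \<Longrightarrow> has_velocity M I c t 0" and "a \<in> I" "b \<in> I"
  shows "c a = c b"
proof (rule connected_local_const[of I])
  show "\<forall>t\<in>I. \<forall>\<^sub>F s in at t within I. c t = c s"
  proof
    fix t assume t: "t \<in> I"
    define p where "p = c t"
    define N where "N = M\<lparr>chart_dom := \<lambda>_. chart_dom M p, chart := \<lambda>_. chart M p\<rparr>"
    have p: "p \<in> points M"
      using has_velocity_points[OF c[OF t]] by (simp add: p_def)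
    have M_p: "regular_chart M p"
      using M p by (rule regular_chart_smooth_manifold)
    have "\<forall>\<^sub>F s in at t within I. c s \<in> chart_dom M p"
      unfolding p_def using c[OF t] M_p
      by (intro has_chart_derivative_eventually_dom) (auto simp: p_def has_velocity_iff)
    then obtain e where e: "e > 0" and "\<And>s. s \<in> I \<Longrightarrow> s \<noteq> t \<Longrightarrow> dist s t < e \<Longrightarrow> c s \<in> chart_dom M p"
      by (auto simp: eventually_at)
    with M_p have dom: "c s \<in> chart_dom M p" if "s \<in> I \<inter> ball t e" for s
      using that by (cases "s = t") (auto simp: p_def regular_chart_def dist_commute)
    have "((\<lambda>r. chart M p (c r)) has_derivative (\<lambda>h. 0)) (at s within I \<inter> ball t e)"
      if s: "s \<in> I \<inter> ball t e" for s
    proof -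
      \<comment> \<open>The zero velocity is given in the chart at \<open>c s\<close>; recentring
        moves it to the chart at \<open>p\<close>.\<close>
      have N: "differentiable_map_at M N (\<lambda>x. x) (c s)"
        unfolding N_def by (rule smooth_manifold_recentre[OF M p dom[OF s]])
      have M_s: "regular_chart M (c s)"
        using M chart_dom_points[OF M_p dom[OF s]] by (rule regular_chart_smooth_manifold)
      have "has_chart_derivative N c s I (\<lambda>h. differential M N (\<lambda>x. x) (c s) (h *\<^sub>R 0))"
        using c[of s] s 
        by (intro has_chart_derivative_compose[where f = c and x = s] M_s N) (auto simp: has_velocity_iff)
      then have "((\<lambda>r. chart N (c s) (c r)) has_derivative (\<lambda>h. 0)) (at s within I)"
        using linear_0[OF linear_differential[OF M_s N]] by (simp add: has_chart_derivative_def)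
      then have "((\<lambda>r. chart M p (c r)) has_derivative (\<lambda>h. 0)) (at s within I)"
        by (simp add: N_def)
      then show ?thesis
        by (rule has_derivative_subset) simp
    qed
    moreover have "convex (I \<inter> ball t e)"
      using I by (intro convex_Int convex_ball is_interval_convex)
    ultimately obtain z where z: "\<And>s. s \<in> I \<inter> ball t e \<Longrightarrow> chart M p (c s) = z"
      using has_derivative_zero_constant[of "I \<inter> ball t e" "\<lambda>r. chart M p (c r)"] by blast
    have "c t = c s" if s: "s \<in> I \<inter> ball t e" for s
    proof -
      have "t \<in> I \<inter> ball t e"
        using t e by simp
      with s z have "chart M p (c t) = chart M p (c s)"
        by metis
      then show ?thesis
        using dom[OF s] dom[OF \<open>t \<in> I \<inter> ball t e\<close>] M_p by (metis chart_inv_chart)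
    qed
    with e show "\<forall>\<^sub>F s in at t within I. c t = c s"
      by (auto simp: eventually_at dist_commute)
  qed
qed (use assms is_interval_connected in auto)

section \<open>Differentials of translations in a Lie group\<close>

locale lie = group G for G :: "'a monoid" (structure) +
  fixes M :: "('a, 'e::euclidean_space) manifold"
  assumes lie_group: "lie_group G M"
begin

lemma smooth_manifold: "smooth_manifold M"
  and points_eq: "points M = carrier G"
  using lie_group by (auto simp: lie_group_def)

lemma regular: "p \<in> carrier G \<Longrightarrow> regular_chart M p"
  by (simp add: regular_chart_smooth_manifold smooth_manifold points_eq)

lemma subspace_model: "subspace (model M)"
  using smooth_manifold by (simp add: smooth_manifold_def)

text \<open>In \<open>rt q p\<close> and \<open>lt q p\<close> the translating element comes first
  and the base point second. Base points other than the unit are needed for the product rule and for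
  cancellation.\<close>

definition rt :: "'a \<Rightarrow> 'a \<Rightarrow> 'e \<Rightarrow> 'e" where
  "rt q p = differential M M (\<lambda>h. h \<otimes> q) p"

definition lt :: "'a \<Rightarrow> 'a \<Rightarrow> 'e \<Rightarrow> 'e" where
  "lt q p = differential M M (\<lambda>h. q \<otimes> h) p"

lemma right_translate_eq: "right_translate G M v g = rt g \<one> v"
  by (simp add: right_translate_def rt_def)

lemma differentiable_mult:
  assumes "p \<in> carrier G" "q \<in> carrier G"
  shows "differentiable_map_at (prod_manifold2 M M) M (\<lambda>(g, h). g \<otimes> h) (p, q)"
  using lie_group assms
  by (intro smooth_map_differentiable) (auto simp: lie_group_def intro: regular regular_chart_prod_manifold2)

lemma has_chart_derivative_mult:
  assumes f: "has_chart_derivative M f x S D" and g: "has_chart_derivative M g x S E" and x: "x \<in> S"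
  shows "has_chart_derivative M (\<lambda>y. f y \<otimes> g y) x S
    (\<lambda>v. differential (prod_manifold2 M M) M (\<lambda>(g, h). g \<otimes> h) (f x, g x) (D v, E v))"
proof -
  have fg: "f x \<in> carrier G" "g x \<in> carrier G"
    using has_chart_derivative_points[OF f] has_chart_derivative_points[OF g] by (auto simp: points_eq)
  show ?thesis
    using has_chart_derivative_compose[OF _ has_chart_derivative_Pair[OF f g] differentiable_mult[OF fg] x]
    by (simp add: regular_chart_prod_manifold2 regular fg)
qed

text \<open>Right translation is multiplication with a constant second factor, so its differential
  is that of multiplication at \<open>(v, 0)\<close>.\<close>

lemma differentiable_right:
  assumes "p \<in> carrier G" "q \<in> carrier G"
  shows "differentiable_map_at M M (\<lambda>h. h \<otimes> q) p"
    and "v \<in> model M \<Longrightarrow>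
      rt q p v = differential (prod_manifold2 M M) M (\<lambda>(g, h). g \<otimes> h) (p, q) (v, 0)"
proof -
  have "has_chart_derivative M (\<lambda>x. chart_inv M p x \<otimes> q) (chart M p p) (model M)
      (\<lambda>v. differential (prod_manifold2 M M) M (\<lambda>(g, h). g \<otimes> h) (p, q) (v, 0))"
    using has_chart_derivative_mult[OF has_chart_derivative_chart_inv[OF regular[OF assms(1)]]
        has_chart_derivative_const[of q] chart_self_in_model[OF regular[OF assms(1)]]] assms
    by (simp add: points_eq chart_inv_chart_self regular)
  from differential_eqI[OF regular[OF assms(1)] this]
  show "differentiable_map_at M M (\<lambda>h. h \<otimes> q) p"
    and "v \<in> model M \<Longrightarrow>
      rt q p v = differential (prod_manifold2 M M) M (\<lambda>(g, h). g \<otimes> h) (p, q) (v, 0)"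
    by (auto simp: rt_def)
qed

lemma differentiable_left:
  assumes "p \<in> carrier G" "q \<in> carrier G"
  shows "differentiable_map_at M M (\<lambda>h. q \<otimes> h) p"
    and "v \<in> model M \<Longrightarrow>
      lt q p v = differential (prod_manifold2 M M) M (\<lambda>(g, h). g \<otimes> h) (q, p) (0, v)"
proof -
  have "has_chart_derivative M (\<lambda>x. q \<otimes> chart_inv M p x) (chart M p p) (model M)
      (\<lambda>v. differential (prod_manifold2 M M) M (\<lambda>(g, h). g \<otimes> h) (q, p) (0, v))"
    using has_chart_derivative_mult[OF has_chart_derivative_const[of q]
        has_chart_derivative_chart_inv[OF regular[OF assms(1)]] chart_self_in_model[OF regular[OF assms(1)]]] assms
    by (simp add: points_eq chart_inv_chart_self regular)
  from differential_eqI[OF regular[OF assms(1)] this]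
  show "differentiable_map_at M M (\<lambda>h. q \<otimes> h) p"
    and "v \<in> model M \<Longrightarrow>
      lt q p v = differential (prod_manifold2 M M) M (\<lambda>(g, h). g \<otimes> h) (q, p) (0, v)"
    by (auto simp: lt_def)
qed

lemma differential_mult:
  assumes "p \<in> carrier G" "q \<in> carrier G" "v \<in> model M" "w \<in> model M"
  shows "differential (prod_manifold2 M M) M (\<lambda>(g, h). g \<otimes> h) (p, q) (v, w) = rt q p v + lt p q w"
proof -
  have "linear (differential (prod_manifold2 M M) M (\<lambda>(g, h). g \<otimes> h) (p, q))"
    using assms by (intro linear_differential differentiable_mult regular_chart_prod_manifold2 regular)
  from linear_add[OF this, of "(v, 0)" "(0, w)"] show ?thesis
    using assms by (simp add: differentiable_left differentiable_right)
qed

lemma linear_rt: "p \<in> carrier G \<Longrightarrow> q \<in> carrier G \<Longrightarrow> linear (rt q p)"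
  unfolding rt_def by (intro linear_differential regular differentiable_right)

lemma linear_lt: "p \<in> carrier G \<Longrightarrow> q \<in> carrier G \<Longrightarrow> linear (lt q p)"
  unfolding lt_def by (intro linear_differential regular differentiable_left)

lemma rt_in_model: "p \<in> carrier G \<Longrightarrow> q \<in> carrier G \<Longrightarrow> v \<in> model M \<Longrightarrow> rt q p v \<in> model M"
  unfolding rt_def by (intro differential_in_model regular differentiable_right) auto

lemma lt_in_model: "p \<in> carrier G \<Longrightarrow> q \<in> carrier G \<Longrightarrow> v \<in> model M \<Longrightarrow> lt q p v \<in> model M"
  unfolding lt_def by (intro differential_in_model regular differentiable_left) auto

text \<open>Associativity, differentiated by the chain rule in the leftmost factor.\<close>

lemma rt_rt:
  assumes "a \<in> carrier G" "b \<in> carrier G" "p \<in> carrier G" "v \<in> model M"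
  shows "rt b (p \<otimes> a) (rt a p v) = rt (a \<otimes> b) p v"
proof -
  note * = differentiable_map_at_compose[OF regular regular differentiable_right(1) differentiable_right(1),
      of p a b]
  have "rt b (p \<otimes> a) (rt a p v) = differential M M (\<lambda>h. (h \<otimes> a) \<otimes> b) p v"
    using assms by (simp add: *(2) rt_def)
  also have "\<dots> = rt (a \<otimes> b) p v"
    unfolding rt_def using assms
    by (intro differentiable_map_at_cong(2)[symmetric] regular *(1)) (auto simp: points_eq m_assoc)
  finally show ?thesis .
qed

lemma lt_lt:
  assumes "a \<in> carrier G" "b \<in> carrier G" "p \<in> carrier G" "v \<in> model M"
  shows "lt b (a \<otimes> p) (lt a p v) = lt (b \<otimes> a) p v"
proof -
  note * = differentiable_map_at_compose[OF regular regular differentiable_left(1) differentiable_left(1),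
      of p a b]
  have "lt b (a \<otimes> p) (lt a p v) = differential M M (\<lambda>h. b \<otimes> (a \<otimes> h)) p v"
    using assms by (simp add: *(2) lt_def)
  also have "\<dots> = lt (b \<otimes> a) p v"
    unfolding lt_def using assms
    by (intro differentiable_map_at_cong(2)[symmetric] regular *(1)) (auto simp: points_eq m_assoc)
  finally show ?thesis .
qed

text \<open>Left and right translations commute by associativity, hence so do their
  differentials.\<close>

lemma lt_rt:
  assumes "a \<in> carrier G" "b \<in> carrier G" "p \<in> carrier G" "v \<in> model M"
  shows "lt b (p \<otimes> a) (rt a p v) = rt a (b \<otimes> p) (lt b p v)"
proof -
  note 1 = differentiable_map_at_compose[OF regular regular differentiable_right(1) differentiable_left(1),
      of p a b]
  note 2 = differentiable_map_at_compose[OF regular regular differentiable_left(1) differentiable_right(1),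
      of p b a]
  have "lt b (p \<otimes> a) (rt a p v) = differential M M (\<lambda>h. b \<otimes> (h \<otimes> a)) p v"
    using assms by (simp add: 1(2) rt_def lt_def)
  also have "\<dots> = differential M M (\<lambda>h. (b \<otimes> h) \<otimes> a) p v"
    using assms
    by (intro differentiable_map_at_cong(2)[symmetric] regular 1(1)) (auto simp: points_eq m_assoc)
  also have "\<dots> = rt a (b \<otimes> p) (lt b p v)"
    using assms by (simp add: 2(2) rt_def lt_def)
  finally show ?thesis .
qed

lemma rt_one:
  assumes "p \<in> carrier G" "v \<in> model M"
  shows "rt \<one> p v = v"
proof -
  have "rt \<one> p v = differential M M (\<lambda>h. h) p v"
    unfolding rt_def using assms
    by (intro differentiable_map_at_cong(2) regular differential_id(1)) (auto simp: points_eq)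
  then show ?thesis
    using assms by (simp add: differential_id regular)
qed

lemma lt_one:
  assumes "p \<in> carrier G" "v \<in> model M"
  shows "lt \<one> p v = v"
proof -
  have "lt \<one> p v = differential M M (\<lambda>h. h) p v"
    unfolding lt_def using assms
    by (intro differentiable_map_at_cong(2) regular differential_id(1)) (auto simp: points_eq)
  then show ?thesis
    using assms by (simp add: differential_id regular)
qed

text \<open>Translation by \<open>inv q\<close> undoes translation by \<open>q\<close>, also on
  tangent vectors.\<close>

lemma rt_inject:
  assumes "p \<in> carrier G" "q \<in> carrier G" "v \<in> model M" "w \<in> model M" "rt q p v = rt q p w"
  shows "v = w"
proof -
  have "rt (inv q) (p \<otimes> q) (rt q p x) = x" if "x \<in> model M" for x
    using rt_rt[of q "inv q" p x] assms(1,2) that by (simp add: rt_one)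
  from this[OF assms(3)] this[OF assms(4)] show ?thesis
    unfolding assms(5) by (rule trans[OF sym])
qed

lemma lt_inject:
  assumes "p \<in> carrier G" "q \<in> carrier G" "v \<in> model M" "w \<in> model M" "lt q p v = lt q p w"
  shows "v = w"
proof -
  have "lt (inv q) (q \<otimes> p) (lt q p x) = x" if "x \<in> model M" for x
    using lt_lt[of q "inv q" p x] assms(1,2) that by (simp add: lt_one)
  from this[OF assms(3)] this[OF assms(4)] show ?thesis
    unfolding assms(5) by (rule trans[OF sym])
qed

lemma differentiable_conjugate:
  assumes g: "g \<in> carrier G"
  shows "differentiable_map_at M M (conjugate G g) \<one>"
    and "v \<in> model M \<Longrightarrow> Ad G M g v = rt (inv g) g (lt g \<one> v)"
proof -
  note * = differentiable_map_at_compose[OF regular regular differentiable_left(1) differentiable_right(1),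
      of \<one> g "inv g"]
  show "differentiable_map_at M M (conjugate G g) \<one>"
    unfolding conjugate_def[abs_def] using g by (intro *(1)) auto
  show "Ad G M g v = rt (inv g) g (lt g \<one> v)" if "v \<in> model M"
    unfolding Ad_def conjugate_def[abs_def] using g that by (simp add: *(2) rt_def lt_def)
qed

lemma linear_Ad: "g \<in> carrier G \<Longrightarrow> linear (Ad G M g)"
  unfolding Ad_def by (intro linear_differential regular differentiable_conjugate) auto

lemma Ad_in_model: "g \<in> carrier G \<Longrightarrow> v \<in> model M \<Longrightarrow> Ad G M g v \<in> model M"
  by (simp add: differentiable_conjugate rt_in_model lt_in_model)

text \<open>The rule \<open>g (v y) = (Ad_g v) (g y)\<close> for moving a group element past a
  tangent vector; it is the source of \<open>Ad\<close> in the reconstruction equation.\<close>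

lemma lt_rt_one:
  assumes "g \<in> carrier G" "y \<in> carrier G" "v \<in> model M"
  shows "lt g y (rt y \<one> v) = rt (g \<otimes> y) \<one> (Ad G M g v)"
proof -
  have "rt g \<one> (Ad G M g v) = lt g \<one> v"
    using assms rt_rt[of "inv g" g g "lt g \<one> v"]
    by (simp add: differentiable_conjugate rt_one lt_in_model)
  then have "rt (g \<otimes> y) \<one> (Ad G M g v) = rt y g (lt g \<one> v)"
    using assms rt_rt[of g y \<one> "Ad G M g v"] by (simp add: Ad_in_model)
  then show ?thesis
    using assms lt_rt[of y g \<one> v] by simp
qed

text \<open>The computation behind the reconstruction equation: if \<open>y\<close> moves with right-trivialised
  velocity \<open>s\<close>, then \<open>b\<close> moves with \<open>u - Ad b s\<close> exactly when \<open>b y\<close> moves with \<open>u\<close>.\<close>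

lemma product_rule_trivialised:
  assumes "b \<in> carrier G" "y \<in> carrier G" "u \<in> model M" "s \<in> model M" "w \<in> model M"
  shows "rt y b w + lt b y (rt y \<one> s) = rt (b \<otimes> y) \<one> u \<longleftrightarrow> w = rt b \<one> (u - Ad G M b s)"
proof -
  have diff: "u - Ad G M b s \<in> model M"
    using assms by (intro subspace_diff subspace_model Ad_in_model)
  have "rt y b (rt b \<one> (u - Ad G M b s)) = rt (b \<otimes> y) \<one> (u - Ad G M b s)"
    using assms diff rt_rt[of b y \<one>] by simp
  also have "\<dots> = rt (b \<otimes> y) \<one> u - lt b y (rt y \<one> s)"
    using assms linear_diff[OF linear_rt[of \<one> "b \<otimes> y"]] by (simp add: lt_rt_one)
  finally have eq: "rt y b (rt b \<one> (u - Ad G M b s)) = rt (b \<otimes> y) \<one> u - lt b y (rt y \<one> s)" .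
  have "rt y b w + lt b y (rt y \<one> s) = rt (b \<otimes> y) \<one> u \<longleftrightarrow>
      rt y b w = rt y b (rt b \<one> (u - Ad G M b s))"
    unfolding eq by (auto simp: algebra_simps)
  also have "\<dots> \<longleftrightarrow> w = rt b \<one> (u - Ad G M b s)"
    using assms diff rt_inject[of b y w "rt b \<one> (u - Ad G M b s)"] by (auto simp: rt_in_model)
  finally show ?thesis .
qed

lemma differentiable_map_at_mult:
  assumes N: "regular_chart N p"
    and F: "differentiable_map_at N M F p" and H: "differentiable_map_at N M H p"
  shows "differentiable_map_at N M (\<lambda>x. F x \<otimes> H x) p"
    and "F p \<in> carrier G \<Longrightarrow> H p \<in> carrier G \<Longrightarrow> v \<in> model N \<Longrightarrow>
      differential N M (\<lambda>x. F x \<otimes> H x) p v =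
        rt (H p) (F p) (differential N M F p v) + lt (F p) (H p) (differential N M H p v)"
proof -
  have *: "has_chart_derivative M (\<lambda>x. F (chart_inv N p x) \<otimes> H (chart_inv N p x)) (chart N p p) (model N)
      (\<lambda>v. differential (prod_manifold2 M M) M (\<lambda>(g, h). g \<otimes> h) (F p, H p)
        (differential N M F p v, differential N M H p v))"
    using has_chart_derivative_mult[OF has_chart_derivative_differential[OF N F]
        has_chart_derivative_differential[OF N H] chart_self_in_model[OF N]]
    by (simp add: chart_inv_chart_self[OF N])
  from differential_eqI(1)[OF N *] show "differentiable_map_at N M (\<lambda>x. F x \<otimes> H x) p" .
  assume "F p \<in> carrier G" "H p \<in> carrier G" "v \<in> model N"
  with differential_eqI(2)[OF N *] show "differential N M (\<lambda>x. F x \<otimes> H x) p v =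
        rt (H p) (F p) (differential N M F p v) + lt (F p) (H p) (differential N M H p v)"
    using differential_in_model[OF N _ F] differential_in_model[OF N _ H]
    by (simp add: differential_mult regular)
qed

section \<open>Velocities of products and uniqueness of trivialised curves\<close>

lemma has_velocity_mult:
  assumes a: "has_velocity M I a t v" and b: "has_velocity M I b t w" and t: "t \<in> I"
  shows "has_velocity M I (\<lambda>s. a s \<otimes> b s) t (rt (b t) (a t) v + lt (a t) (b t) w)"
proof -
  have ab: "a t \<in> carrier G" "b t \<in> carrier G"
    using has_velocity_points[OF a] has_velocity_points[OF b] by (auto simp: points_eq)
  have v: "v \<in> model M" and w: "w \<in> model M"
    using a b by (auto simp: has_velocity_iff)
  have "has_chart_derivative M (\<lambda>s. a s \<otimes> b s) t I
      (\<lambda>r. differential (prod_manifold2 M M) M (\<lambda>(g, h). g \<otimes> h) (a t, b t) (r *\<^sub>R v, r *\<^sub>R w))"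
    using a b t by (intro has_chart_derivative_mult) (auto simp: has_velocity_iff)
  moreover have "differential (prod_manifold2 M M) M (\<lambda>(g, h). g \<otimes> h) (a t, b t) (r *\<^sub>R v, r *\<^sub>R w) =
      r *\<^sub>R (rt (b t) (a t) v + lt (a t) (b t) w)" for r
    using ab v w linear_cmul[OF linear_rt] linear_cmul[OF linear_lt]
    by (simp add: differential_mult subspace_scale subspace_model scaleR_right_distrib)
  moreover have "rt (b t) (a t) v + lt (a t) (b t) w \<in> model M"
    using ab v w by (intro subspace_add subspace_model rt_in_model lt_in_model)
  ultimately show ?thesis
    by (simp add: has_velocity_iff)
qed

lemma differentiable_inv:
  "p \<in> carrier G \<Longrightarrow> differentiable_map_at M M (\<lambda>g. inv g) p"
  using lie_group by (intro smooth_map_differentiable) (auto simp: lie_group_def regular)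

text \<open>The velocity \<open>u\<close> may be arbitrarily irregular in \<open>t\<close>: the quotient of two solutions has
  velocity \<open>0\<close>, so no Picard-Lindeloef argument is needed.\<close>

lemma right_trivialised_unique:
  assumes I: "is_interval I" and t0: "t0 \<in> I" "a t0 = b t0"
    and u: "\<And>t. t \<in> I \<Longrightarrow> u t \<in> model M"
    and a: "\<And>t. t \<in> I \<Longrightarrow> has_velocity M I a t (rt (a t) \<one> (u t))"
    and b: "\<And>t. t \<in> I \<Longrightarrow> has_velocity M I b t (rt (b t) \<one> (u t))"
    and t: "t \<in> I"
  shows "a t = b t"
proof (cases "t = t0")
  case False
  have ac: "a s \<in> carrier G" and bc: "b s \<in> carrier G" if "s \<in> I" for s
    using has_velocity_points[OF a[OF that]] has_velocity_points[OF b[OF that]] by (auto simp: points_eq)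
  define c where "c s = inv (a s) \<otimes> b s" for s
  have "has_velocity M I c s 0" if s: "s \<in> I" for s
  proof -
    have "connected I"
      using I by (rule is_interval_connected)
    \<comment> \<open>As \<open>t\<close> and \<open>t0\<close> differ, \<open>I\<close> has no
      isolated points, which uniqueness of velocities requires.\<close>
    moreover have "I \<noteq> {x}" for x
      using False t0 t by auto
    ultimately have nt: "at s within I \<noteq> bot"
      using s connected_imp_perfect trivial_limit_within by blast
    have "has_velocity M I (\<lambda>s. inv (a s)) s (differential M M (\<lambda>g. inv g) (a s) (rt (a s) \<one> (u s)))"
      using ac[OF s] by (intro has_velocity_compose a s regular differentiable_inv) auto
    \<comment> \<open>Only the existence of a velocity of \<open>c\<close> is taken from the product
      rule; its value comes from the identity \<open>b = a c\<close>.\<close>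
    then obtain w where w: "has_velocity M I c s w"
      using has_velocity_mult[OF _ b[OF s] s] unfolding c_def by blast
    have wm: "w \<in> model M"
      using w by (simp add: has_velocity_iff)
    have cs: "c r \<in> carrier G" "a r \<otimes> c r = b r" if "r \<in> I" for r
      using ac[OF that] bc[OF that] by (auto simp: c_def m_assoc[symmetric])
    \<comment> \<open>In the velocity of \<open>a c\<close> the first summand is already the
      velocity prescribed for \<open>b\<close>, so the summand containing \<open>w\<close> must
      vanish.\<close>
    have "has_velocity M I b s (rt (c s) (a s) (rt (a s) \<one> (u s)) + lt (a s) (c s) w)"
      by (rule has_velocity_cong[OF has_velocity_mult[OF a[OF s] w s] s cs(2)])
    from has_velocity_unique[OF this b[OF s] nt]
    have "lt (a s) (c s) w = 0"
      using rt_rt[of "a s" "c s" \<one> "u s"] ac[OF s] cs[OF s] u[OF s] by simp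
    then have "lt (a s) (c s) w = lt (a s) (c s) 0"
      using linear_0[OF linear_lt] ac[OF s] cs[OF s] by simp
    then have "w = 0"
      using lt_inject ac[OF s] cs[OF s] wm subspace_0[OF subspace_model] by blast
    with w show ?thesis
      by simp
  qed
  from constant_if_zero_velocity[OF smooth_manifold I this t0(1) t]
  have "c t = \<one>"
    using ac bc t0 by (simp add: c_def)
  then show ?thesis
    using ac[OF t] bc[OF t] unfolding c_def by (metis inv_closed inv_equality inv_inv)
qed (use t0 in simp)

end

section \<open>Chains of Lie groups\<close>

text \<open>The three properties are bundled into one relation because transitivity mixes them:
  composing inclusions needs the points of the smaller group to lie in the middle one.\<close>

lemma lie_chain_incl:
  assumes chain: "lie_chain G M" and "k < l"
  shows "carrier (G l) \<subseteq> carrier (G k) \<and>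
    (\<forall>x\<in>carrier (G l). \<forall>y\<in>carrier (G l). x \<otimes>\<^bsub>G l\<^esub> y = x \<otimes>\<^bsub>G k\<^esub> y) \<and>
    (\<forall>p\<in>carrier (G l). differentiable_map_at (M l) (M k) (\<lambda>x. x) p)"
    (is "?R k l")
proof -
  have lie: "lie (G k) (M k)" for k
    using chain by (simp add: lie_chain_def lie_group_def lie_def lie_axioms_def)
  show ?thesis
  proof (rule less_induct_consecutive[OF \<open>k < l\<close>])
    fix k l :: 'a
    assume "k < l" "\<not> (\<exists>i. k < i \<and> i < l)"
    with chain have sub: "lie_subgroup (G l) (M l) (G k) (M k)"
      by (simp add: lie_chain_def)
    then have subset: "carrier (G l) \<subseteq> carrier (G k)"
      by (auto simp: lie_subgroup_def dest: subgroup.subset)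
    have "differentiable_map_at (M l) (M k) (\<lambda>x. x) p" if "p \<in> carrier (G l)" for p
    proof (rule smooth_map_differentiable)
      show "smooth_map (M l) (M k) (\<lambda>x. x)"
        using sub by (simp add: lie_subgroup_def)
      show "regular_chart (M l) p" "regular_chart (M k) p"
        using that subset by (auto intro: lie.regular[OF lie])
    qed
    with sub subset show "?R k l"
      by (simp add: lie_subgroup_def)
  next
    fix k m l :: 'a
    assume R: "?R k m" "?R m l"
    have "differentiable_map_at (M l) (M k) (\<lambda>x. x) p" if p: "p \<in> carrier (G l)" for p
      by (rule differentiable_map_at_compose(1)[where F = "\<lambda>x. x" and H = "\<lambda>x. x" and N = "M m"])
        (use R p lie.regular[OF lie] in auto)
    with R show "?R k l"
      by (auto simp: subset_iff)
  qed
qed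

locale chain_of_lie_groups =
  fixes G :: "'n::{finite,linorder} \<Rightarrow> 'a monoid"
    and M :: "'n \<Rightarrow> ('a, 'e::euclidean_space) manifold"
  assumes lie_chain: "lie_chain G M"
begin

lemma lie: "lie (G k) (M k)"
  using lie_chain by (simp add: lie_chain_def lie_group_def lie_def lie_axioms_def)

sublocale group_chain G
proof (rule group_chain.intro)
  show "Group.group (G k)" for k
    using lie by (simp add: lie_def)
  show "carrier (G l) \<subseteq> carrier (G k)" if "k < l" for k l
    using lie_chain_incl[OF lie_chain that] by blast
  show "x \<otimes>\<^bsub>G l\<^esub> y = x \<otimes>\<^bsub>G k\<^esub> y"
    if "k < l" "x \<in> carrier (G l)" "y \<in> carrier (G l)" for k l x y
    using lie_chain_incl[OF lie_chain that(1)] that by blast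
qed

abbreviation "rt k \<equiv> lie.rt (G k) (M k)"
abbreviation "lt k \<equiv> lie.lt (G k) (M k)"
abbreviation "P \<equiv> prod_manifold M"

lemma differentiable_incl:
  "k < l \<Longrightarrow> p \<in> carrier (G l) \<Longrightarrow> differentiable_map_at (M l) (M k) (\<lambda>x. x) p"
  using lie_chain_incl[OF lie_chain] by blast

lemma regular: "p \<in> carrier (G k) \<Longrightarrow> regular_chart (M k) p"
  by (rule lie.regular[OF lie])

lemma regular_P: "g \<in> carrier (semidirect G) \<Longrightarrow> regular_chart P g"
  by (rule regular_chart_prod_manifold, rule regular) (simp add: carrier_semidirect)

lemma points_P: "points P = carrier (semidirect G)"
  using lie.points_eq[OF lie] by (auto simp: carrier_semidirect PiE_UNIV_domain Pi_iff)

lemma one_closed: "\<one>\<^bsub>G k\<^esub> \<in> carrier (G k)"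
  by (simp add: monoid.one_closed)

lemma in_carrier: "g \<in> carrier (semidirect G) \<Longrightarrow> g k \<in> carrier (G k)"
  by (simp add: carrier_semidirect)

lemma differential_apply:
  assumes "g \<in> carrier (semidirect G)"
  shows "differentiable_map_at P (M k) (\<lambda>h. h k) g"
    and "v \<in> model P \<Longrightarrow> differential P (M k) (\<lambda>h. h k) g v = v $ k"
  using differential_component(1)[of M g k] differential_component(2)[of M g v k] assms
  by (auto intro: regular in_carrier)

section \<open>Differentials of tail and total products\<close>

text \<open>A point has separate charts in \<open>M m\<close> and \<open>M k\<close>, so the
  inclusion is a genuine map: the tail product at \<open>k\<close> is the total product at the
  successor \<open>m\<close>, followed by the inclusion.\<close>

lemma differentiable_prod:
  assumes g: "g \<in> carrier (semidirect G)"
  shows "differentiable_map_at P (M k) (tail_prod G k) g"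
    and "differentiable_map_at P (M k) (total_prod k) g"
proof -
  have "differentiable_map_at P (M k) (tail_prod G k) g \<and> differentiable_map_at P (M k) (total_prod k) g"
  proof (induction k rule: finite_linorder_upward_induct)
    case (greater k)
    have tail: "differentiable_map_at P (M k) (tail_prod G k) g"
    proof (cases k rule: finite_linorder_succ_cases)
      case max
      then have "tail_prod G k = (\<lambda>_. \<one>\<^bsub>G k\<^esub>)"
        by (auto simp: tail_prod_max)
      then show ?thesis
        using differentiable_map_at_const(1)[OF regular_P[OF g], where N = "M k"] lie.points_eq[OF lie] one_closed
        by simp
    next
      case (succ m)
      have "differentiable_map_at P (M k) (\<lambda>h. total_prod m h) g"
        by (rule differentiable_map_at_compose(1)[where F = "total_prod m" and H = "\<lambda>x. x" and N = "M m"])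
          (use greater succ g total_prod_closed[OF g] in \<open>auto intro: regular_P regular differentiable_incl\<close>)
      then show ?thesis
        by (rule differentiable_map_at_cong(1)[OF regular_P[OF g]])
          (use succ in \<open>simp add: points_P tail_prod_succ del: prod_manifold_simps\<close>)
    qed
    then have "differentiable_map_at P (M k) (\<lambda>h. h k \<otimes>\<^bsub>G k\<^esub> tail_prod G k h) g"
      using g by (intro lie.differentiable_map_at_mult(1)[OF lie] regular_P differential_apply)
    with tail show ?case
      by (simp add: total_prod_def[abs_def])
  qed
  then show "differentiable_map_at P (M k) (tail_prod G k) g"
    and "differentiable_map_at P (M k) (total_prod k) g"
    by blast+
qed

lemma differential_total_prod:
  assumes g: "g \<in> carrier (semidirect G)" and v: "v \<in> model P"
  shows "differential P (M k) (total_prod k) g v =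
    rt k (tail_prod G k g) (g k) (v $ k) + lt k (g k) (tail_prod G k g) (differential P (M k) (tail_prod G k) g v)"
  using lie.differentiable_map_at_mult(2)[OF lie regular_P[OF g] differential_apply(1)[OF g]
      differentiable_prod(1)[OF g] in_carrier[OF g] tail_prod_closed[OF g] v] v
  by (simp add: total_prod_def[abs_def] differential_apply(2)[OF g] del: prod_manifold_simps)

lemma lie_incl_compose:
  assumes "k < m" "m < i" "v \<in> model (M i)"
  shows "lie_incl G M m k (lie_incl G M i m v) = lie_incl G M i k v"
proof -
  have one: "\<one>\<^bsub>G i\<^esub> \<in> carrier (G i)" "\<one>\<^bsub>G i\<^esub> \<in> carrier (G m)"
    using one_closed carrier_mono[OF assms(2)] by blast+
  have "differential (M i) (M k) (\<lambda>x. x) \<one>\<^bsub>G i\<^esub> v =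
      differential (M m) (M k) (\<lambda>x. x) \<one>\<^bsub>G i\<^esub> (differential (M i) (M m) (\<lambda>x. x) \<one>\<^bsub>G i\<^esub> v)"
    using one assms(3)
    by (intro differentiable_map_at_compose(2)[where F = "\<lambda>x. x" and H = "\<lambda>x. x"] regular
        differentiable_incl assms(1,2))
  then show ?thesis
    by (simp add: lie_incl_def one_eq[OF assms(2)])
qed

lemma linear_lie_incl: "k < i \<Longrightarrow> linear (lie_incl G M i k)"
  unfolding lie_incl_def by (intro linear_differential regular differentiable_incl one_closed)

lemma lie_incl_in_model: "k < i \<Longrightarrow> v \<in> model (M i) \<Longrightarrow> lie_incl G M i k v \<in> model (M k)"
  unfolding lie_incl_def
  by (intro differential_in_model regular differentiable_incl one_closed carrier_mono[OF _ one_closed])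

lemma subspace_model: "subspace (model (M k))"
  by (rule lie.subspace_model[OF lie])

lemma tail_sum_in_model: "v \<in> model P \<Longrightarrow> tail_sum G M k v \<in> model (M k)"
  unfolding tail_sum_def by (intro subspace_sum subspace_model lie_incl_in_model) auto

lemma tail_sum_max: "{k<..} = {} \<Longrightarrow> tail_sum G M k v = 0"
  by (simp add: tail_sum_def)

text \<open>The infinitesimal counterpart of \<open>tail_prod_succ\<close>, from linearity and
  functoriality of the inclusions of Lie algebras.\<close>

lemma tail_sum_succ:
  assumes "k < m" "{k<..} = insert m {m<..}" "v \<in> model P"
  shows "tail_sum G M k v = lie_incl G M m k (v $ m + tail_sum G M m v)"
proof -
  have "lie_incl G M m k (v $ m + tail_sum G M m v) =
      lie_incl G M m k (v $ m) + (\<Sum>i\<in>{m<..}. lie_incl G M m k (lie_incl G M i m (v $ i)))"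
    using linear_lie_incl[OF \<open>k < m\<close>] by (simp add: tail_sum_def linear_add linear_sum)
  also have "(\<Sum>i\<in>{m<..}. lie_incl G M m k (lie_incl G M i m (v $ i))) = (\<Sum>i\<in>{m<..}. lie_incl G M i k (v $ i))"
    using assms by (intro sum.cong refl lie_incl_compose) auto
  finally show ?thesis
    by (simp add: tail_sum_def assms(2))
qed

abbreviation "e \<equiv> \<one>\<^bsub>semidirect G\<^esub>"

lemma e_apply: "e k = \<one>\<^bsub>G k\<^esub>"
  by (simp add: one_semidirect)

text \<open>At the unit both translations in the product rule are identities, so products
  differentiate to sums.\<close>

lemma differential_prod_one:
  assumes v: "v \<in> model P"
  shows "differential P (M k) (tail_prod G k) e v = tail_sum G M k v"
    and "differential P (M k) (total_prod k) e v = v $ k + tail_sum G M k v"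
proof -
  note e = semidirect_one_closed
  have "differential P (M k) (tail_prod G k) e v = tail_sum G M k v \<and>
    differential P (M k) (total_prod k) e v = v $ k + tail_sum G M k v"
  proof (induction k rule: finite_linorder_upward_induct)
    case (greater k)
    have tail: "differential P (M k) (tail_prod G k) e v = tail_sum G M k v"
    proof (cases k rule: finite_linorder_succ_cases)
      case max
      then have "tail_prod G k = (\<lambda>_. \<one>\<^bsub>G k\<^esub>)"
        by (auto simp: tail_prod_max)
      then show ?thesis
        using differentiable_map_at_const(2)[OF regular_P[OF e] _ v, where N = "M k"] lie.points_eq[OF lie] one_closed max
        by (simp add: tail_sum_max)
    next
      case (succ m)
      note compose = differentiable_map_at_compose[where F = "total_prod m" and H = "\<lambda>x. x" and N = "M m",
          OF regular_P[OF e] regular[OF total_prod_closed[OF e]] differentiable_prod(2)[OF e]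
            differentiable_incl[OF succ(1) total_prod_closed[OF e]]]
      have "differential P (M k) (tail_prod G k) e v = differential P (M k) (\<lambda>h. total_prod m h) e v"
        by (rule differentiable_map_at_cong(2)[OF regular_P[OF e] compose(1) _ v])
          (use succ in \<open>simp add: points_P tail_prod_succ del: prod_manifold_simps\<close>)
      also have "\<dots> = lie_incl G M m k (differential P (M m) (total_prod m) e v)"
        using compose(2)[OF v] by (simp add: lie_incl_def prod_one)
      finally show ?thesis
        using greater succ v by (simp add: tail_sum_succ del: prod_manifold_simps)
    qed
    moreover have "differential P (M k) (total_prod k) e v = v $ k + tail_sum G M k v"
      using differential_total_prod[OF e v, of k] tail tail_sum_in_model[OF v, of k] v one_closed
        lie.rt_one[OF lie, of _ k] lie.lt_one[OF lie, of _ k]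
      by (simp add: prod_one e_apply)
    ultimately show ?case
      by blast
  qed
  then show "differential P (M k) (tail_prod G k) e v = tail_sum G M k v"
    and "differential P (M k) (total_prod k) e v = v $ k + tail_sum G M k v"
    by blast+
qed

section \<open>Right translation in the semidirect product\<close>

text \<open>Each component is \<open>h_k y g_k y^-1\<close> with \<open>y\<close> the tail product
  of \<open>h\<close>. This makes \<open>right_translate\<close> in the semidirect product a true
  derivative and not an arbitrary choice.\<close>

lemma differentiable_right_semidirect:
  assumes g: "g \<in> carrier (semidirect G)" and h: "h \<in> carrier (semidirect G)"
  shows "differentiable_map_at P P (\<lambda>h. h \<otimes>\<^bsub>semidirect G\<^esub> g) h"
proof (rule differentiable_map_at_vecI[OF regular_P[OF h]])
  fix k
  note mult = lie.differentiable_map_at_mult(1)[OF lie regular_P[OF h]]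
  have const: "differentiable_map_at P (M k) (\<lambda>_. g k) h"
    using lie.points_eq[OF lie] g
    by (intro differentiable_map_at_const(1)[OF regular_P[OF h]]) (simp add: carrier_semidirect)
  have inv: "differentiable_map_at P (M k) (\<lambda>h. inv\<^bsub>G k\<^esub> tail_prod G k h) h"
    by (rule differentiable_map_at_compose(1)[where F = "tail_prod G k" and N = "M k"])
      (use tail_prod_closed[OF h] in
        \<open>auto intro: lie.differentiable_inv[OF lie] regular_P[OF h] regular differentiable_prod(1)[OF h]\<close>)
  show "differentiable_map_at P (M k) (\<lambda>h. (h \<otimes>\<^bsub>semidirect G\<^esub> g) k) h"
    unfolding mult_semidirect conjugate_def
    using h const inv by (intro mult differential_apply differentiable_prod)
qed

lemma right_translate_semidirect_in_model:
  assumes "g \<in> carrier (semidirect G)" "v \<in> model P"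
  shows "right_translate (semidirect G) P v g \<in> model P"
  unfolding right_translate_def using assms
  by (intro differential_in_model regular_P differentiable_right_semidirect semidirect_one_closed
      semidirect_mult_closed)

text \<open>Differentiating \<open>F (h g) = F h F g\<close> in \<open>h\<close> at the unit:
  homomorphisms intertwine right translations.\<close>

lemma differential_hom_right_translate:
  assumes g: "g \<in> carrier (semidirect G)" and v: "v \<in> model P"
    and F: "\<And>h. h \<in> carrier (semidirect G) \<Longrightarrow> differentiable_map_at P (M k) F h"
    and hom: "F \<in> hom (semidirect G) (G k)"
  shows "differential P (M k) F g (right_translate (semidirect G) P v g) =
    rt k (F g) \<one>\<^bsub>G k\<^esub> (differential P (M k) F e v)"
proof -
  note e = semidirect_one_closed
  have eg: "e \<otimes>\<^bsub>semidirect G\<^esub> g = g"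
    using g semidirect_group by (simp add: monoid.l_one group.is_monoid)
  have closed: "F h \<in> carrier (G k)" if "h \<in> carrier (semidirect G)" for h
    using hom that by (auto simp: hom_def)
  have Fe: "F e = \<one>\<^bsub>G k\<^esub>"
    using hom semidirect_group group hom_one by blast
  note left = differentiable_map_at_compose[OF regular_P[OF e] regular_P differentiable_right_semidirect[OF g e] F,
      unfolded eg, OF g g]
  note right = differentiable_map_at_compose[where M = P and p = e and F = F, OF regular_P[OF e] regular[OF closed[OF e]] F[OF e]
      lie.differentiable_right(1)[OF lie closed[OF e] closed[OF g]]]
  have "differential P (M k) F g (right_translate (semidirect G) P v g) =
      differential P (M k) (\<lambda>h. F (h \<otimes>\<^bsub>semidirect G\<^esub> g)) e v"
    using left(2)[OF v] by (simp add: right_translate_def)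
  also have "\<dots> = differential P (M k) (\<lambda>h. F h \<otimes>\<^bsub>G k\<^esub> F g) e v"
    by (rule differentiable_map_at_cong(2)[OF regular_P[OF e] right(1) _ v])
      (use hom g in \<open>simp add: points_P hom_mult del: prod_manifold_simps\<close>)
  also have "\<dots> = rt k (F g) \<one>\<^bsub>G k\<^esub> (differential P (M k) F e v)"
    using right(2)[OF v] by (simp add: lie.rt_def[OF lie] Fe)
  finally show ?thesis .
qed

lemma differential_tail_prod_right_translate:
  assumes "g \<in> carrier (semidirect G)" "v \<in> model P"
  shows "differential P (M k) (tail_prod G k) g (right_translate (semidirect G) P v g) =
    rt k (tail_prod G k g) \<one>\<^bsub>G k\<^esub> (tail_sum G M k v)"
proof -
  have "tail_prod G k \<in> hom (semidirect G) (G k)"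
    by (intro homI tail_prod_closed prod_mult)
  from differential_hom_right_translate[OF assms differentiable_prod(1) this] show ?thesis
    unfolding differential_prod_one(1)[OF assms(2)] .
qed

lemma differential_total_prod_right_translate:
  assumes "g \<in> carrier (semidirect G)" "v \<in> model P"
  shows "differential P (M k) (total_prod k) g (right_translate (semidirect G) P v g) =
    rt k (total_prod k g) \<one>\<^bsub>G k\<^esub> (v $ k + tail_sum G M k v)"
proof -
  have "total_prod k \<in> hom (semidirect G) (G k)"
    by (intro homI total_prod_closed prod_mult)
  from differential_hom_right_translate[OF assms differentiable_prod(2) this] show ?thesis
    unfolding differential_prod_one(2)[OF assms(2)] .
qed

section \<open>The reconstruction equation\<close>

text \<open>Uniform in \<open>k\<close>: at the largest index the tail sum is empty and the formula
  reduces to that of the last equation.\<close>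

definition ode_rhs :: "'n \<Rightarrow> ('e, 'n) vec \<Rightarrow> 'a \<Rightarrow> 'e" where
  "ode_rhs k v b = rt k b \<one>\<^bsub>G k\<^esub> (v $ k + tail_sum G M k v - Ad (G k) (M k) b (tail_sum G M k v))"

lemma total_in_model: "v \<in> model P \<Longrightarrow> v $ k + tail_sum G M k v \<in> model (M k)"
  using tail_sum_in_model[of v k] by (simp add: subspace_add subspace_model)

text \<open>The differential of \<open>total_prod k\<close> on the translated vector is computed
  twice, by the product rule and by the homomorphism property. Equating both,
  \<open>product_rule_trivialised\<close> solves for component \<open>k\<close>.\<close>

lemma right_translate_semidirect_component:
  assumes g: "g \<in> carrier (semidirect G)" and v: "v \<in> model P"
  shows "right_translate (semidirect G) P v g $ k = ode_rhs k v (g k)"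
proof -
  let ?w = "right_translate (semidirect G) P v g"
  have w: "?w \<in> model P"
    using g v by (rule right_translate_semidirect_in_model)
  have "rt k (tail_prod G k g) (g k) (?w $ k) +
      lt k (g k) (tail_prod G k g) (rt k (tail_prod G k g) \<one>\<^bsub>G k\<^esub> (tail_sum G M k v)) =
      rt k (g k \<otimes>\<^bsub>G k\<^esub> tail_prod G k g) \<one>\<^bsub>G k\<^esub> (v $ k + tail_sum G M k v)"
    using differential_total_prod[OF g w, of k] differential_total_prod_right_translate[OF g v, of k]
      differential_tail_prod_right_translate[OF g v, of k] by (simp add: total_prod_def)
  then show ?thesis
    unfolding ode_rhs_def
    using lie.product_rule_trivialised[OF lie in_carrier[OF g] tail_prod_closed[OF g]
        total_in_model[OF v] tail_sum_in_model[OF v], of "?w $ k" k] w by simp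
qed

lemma solves_reconstruction_ode_iff:
  "solves_reconstruction_ode G M I v g \<longleftrightarrow>
    (\<forall>t\<in>I. \<forall>k. has_velocity (M k) I (\<lambda>s. g s k) t (ode_rhs k (v t) (g t k)))"
proof -
  have max: "right_translate (G n) (M n) (w $ n) b = ode_rhs n w b"
    if "b \<in> carrier (G n)" "n = Max UNIV" for w b n
  proof -
    have "{n<..} = {}"
      using that(2) by (auto simp: not_less)
    then show ?thesis
      using that(1) linear_0[OF lie.linear_Ad[OF lie]]
      by (simp add: ode_rhs_def tail_sum_max lie.right_translate_eq[OF lie])
  qed
  \<comment> \<open>Either velocity statement already forces \<open>g t n\<close> into the carrier,
    as \<open>max\<close> demands.\<close>
  have vel: "has_velocity (M n) I (\<lambda>s. g s n) t (right_translate (G n) (M n) (v t $ n) (g t n)) \<longleftrightarrow>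
      has_velocity (M n) I (\<lambda>s. g s n) t (ode_rhs n (v t) (g t n))" if "n = Max UNIV" for n t
    using max[OF _ that] has_velocity_points lie.points_eq[OF lie] by metis
  have all: "(\<forall>k. k < Max UNIV \<longrightarrow> Q k) \<and> Q (Max UNIV) \<longleftrightarrow> (\<forall>k. Q k)" for Q :: "'n \<Rightarrow> bool"
    by (metis Max_ge UNIV_I finite_UNIV finite_code order_le_less)
  show ?thesis
    unfolding solves_reconstruction_ode_def Let_def vel[OF refl]
    by (simp add: ode_rhs_def lie.right_translate_eq[OF lie] add_diff_eq, intro ball_cong refl, rule all)
qed

lemma reconstruction:
  assumes v: "right_trivialised_tangent (semidirect G) P I g v"
  shows "solves_reconstruction_ode G M I v g"
  unfolding solves_reconstruction_ode_iff
proof (intro ballI allI)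
  fix t k assume "t \<in> I"
  with v have vt: "v t \<in> model P" and vel: "has_velocity P I g t (right_translate (semidirect G) P (v t) (g t))"
    unfolding right_trivialised_tangent_def by blast+
  have "g t \<in> carrier (semidirect G)"
    using has_velocity_points[OF vel] unfolding points_P .
  then show "has_velocity (M k) I (\<lambda>s. g s k) t (ode_rhs k (v t) (g t k))"
    using has_velocity_component[OF vel, of k] vt by (simp add: right_translate_semidirect_component del: prod_manifold_simps)
qed

lemma reconstruction_unique:
  assumes I: "is_interval I" and v: "right_trivialised_tangent (semidirect G) P I g v"
    and g': "solves_reconstruction_ode G M I v g'"
    and t0: "t0 \<in> I" "g' t0 = g t0" and t: "t \<in> I"
  shows "g' t = g t"
proof
  fix k
  have vs: "v s \<in> model P" and vel: "has_velocity P I g s (right_translate (semidirect G) P (v s) (g s))"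
    and gs: "g s \<in> carrier (semidirect G)" if "s \<in> I" for s
  proof -
    have *: "v s \<in> model P \<and> has_velocity P I g s (right_translate (semidirect G) P (v s) (g s))"
      using v that unfolding right_trivialised_tangent_def by (rule bspec)
    then show "v s \<in> model P" and vel: "has_velocity P I g s (right_translate (semidirect G) P (v s) (g s))"
      by blast+
    show "g s \<in> carrier (semidirect G)"
      using has_velocity_points[OF vel] unfolding points_P .
  qed
  \<comment> \<open>The tail of the given curve \<open>g\<close> multiplies both \<open>g k\<close>
    and \<open>g' k\<close>. Each index is thus treated on its own, without recursion over the
    larger ones.\<close>
  define y where "y s = tail_prod G k (g s)" for s
  have y: "y s \<in> carrier (G k)" if "s \<in> I" for s
    using gs[OF that] by (simp add: y_def tail_prod_closed)
  have y_vel: "has_velocity (M k) I y s (rt k (y s) \<one>\<^bsub>G k\<^esub> (tail_sum G M k (v s)))" if "s \<in> I" for s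
    using has_velocity_compose[OF regular_P[OF gs[OF that]] vel[OF that] _ differentiable_prod(1)[OF gs[OF that]] that,
        of k] tail_prod_closed[OF gs[OF that], of k]
    by (simp add: regular differential_tail_prod_right_translate gs vs that y_def[abs_def] del: prod_manifold_simps)
  have prod: "has_velocity (M k) I (\<lambda>s. b s \<otimes>\<^bsub>G k\<^esub> y s) s
      (rt k (b s \<otimes>\<^bsub>G k\<^esub> y s) \<one>\<^bsub>G k\<^esub> (v s $ k + tail_sum G M k (v s)))"
    if s: "s \<in> I" and b: "has_velocity (M k) I b s (ode_rhs k (v s) (b s))" for b s
  proof -
    have "b s \<in> carrier (G k)" "ode_rhs k (v s) (b s) \<in> model (M k)"
      using has_velocity_points[OF b] b lie.points_eq[OF lie] by (auto simp: has_velocity_iff)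
    then have "rt k (y s) (b s) (ode_rhs k (v s) (b s)) +
        lt k (b s) (y s) (rt k (y s) \<one>\<^bsub>G k\<^esub> (tail_sum G M k (v s))) =
        rt k (b s \<otimes>\<^bsub>G k\<^esub> y s) \<one>\<^bsub>G k\<^esub> (v s $ k + tail_sum G M k (v s))"
      using lie.product_rule_trivialised[OF lie _ y[OF s] total_in_model[OF vs[OF s]] tail_sum_in_model[OF vs[OF s]]]
      by (simp add: ode_rhs_def)
    then show ?thesis
      using lie.has_velocity_mult[OF lie b y_vel[OF s] s] by simp
  qed
  have g_vel: "has_velocity (M k) I (\<lambda>s. g s k) s (ode_rhs k (v s) (g s k))"
    and g'_vel: "has_velocity (M k) I (\<lambda>s. g' s k) s (ode_rhs k (v s) (g' s k))" if "s \<in> I" for s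
    using reconstruction[OF v] g' that unfolding solves_reconstruction_ode_iff by blast+
  have "g' t k \<otimes>\<^bsub>G k\<^esub> y t = g t k \<otimes>\<^bsub>G k\<^esub> y t"
    by (rule lie.right_trivialised_unique[OF lie[of k] I t0(1), where u = "\<lambda>s. v s $ k + tail_sum G M k (v s)"])
      (use t0 t in \<open>simp_all add: prod[OF _ g_vel] prod[OF _ g'_vel] total_in_model[OF vs]\<close>)
  moreover have "g t k \<in> carrier (G k)" "g' t k \<in> carrier (G k)"
    using has_velocity_points[OF g_vel[OF t]] has_velocity_points[OF g'_vel[OF t]] lie.points_eq[OF lie] by auto
  ultimately show "g' t k = g t k"
    using y[OF t] by (simp add: group.right_cancel)
qed

end

text \<open>Reconstructibility is rendered as solving the equation together with uniqueness among
  solutions that meet the curve at a single time.\<close>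

theorem lemma2p5:
  fixes G :: "'n::{finite,linorder} \<Rightarrow> 'a monoid"
    and M :: "'n \<Rightarrow> ('a, 'e::euclidean_space) manifold"
  assumes "lie_chain G M"
  shows "group (semidirect G) \<and>
    (\<forall>k. sub_product G k \<lhd> semidirect G) \<and>
    (\<forall>I (g :: real \<Rightarrow> 'n \<Rightarrow> 'a) (v :: real \<Rightarrow> ('e, 'n) vec).
       is_interval I \<and> right_trivialised_tangent (semidirect G) (prod_manifold M) I g v \<longrightarrow>
         solves_reconstruction_ode G M I v g \<and>
         (\<forall>g'. solves_reconstruction_ode G M I v g' \<and> (\<exists>t\<in>I. g' t = g t) \<longrightarrow>
               (\<forall>t\<in>I. g' t = g t)))"
proof -
  interpret chain_of_lie_groups G M
    using assms by unfold_locales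
  show ?thesis
    using semidirect_group sub_product_normal reconstruction reconstruction_unique by blast
qed

end
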